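(* For every constant $p\in\mathbb{R}$ with $0<p<1$ there exists $\varepsilon>0$ such that the random graph $G\sim G(n,p)$ is asymptotically almost surely rigid in $\mathbb{R}^{\lfloor\varepsilon n\rfloor}$.
   Context: $G(n,p)$ is the Erdős–Rényi random graph on $n$ vertices in which each pair is an edge independently with probability $p$; "asymptotically almost surely" means with probability tending to $1$ as $n\to\infty$. A graph is rigid in $\mathbb{R}^d$ if some (equivalently every) generic $d$-dimensional bar-and-joint framework of it (vertex positions with coordinates algebraically independent over $\mathbb{Q}$) is rigid, i.e. admits no continuous edge-length-preserving motion changing some pairwise distance. *)

theory Defs
  imports Complex_Main
begin

text \<open>Simple graphs on vertex set {0..<n}: edges are pairs (i,j) with i < j < n.\<close>
definition all_pairs :: "nat \<Rightarrow> (nat \<times> nat) set" where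
  "all_pairs n = {(i, j). i < j \<and> j < n}"

definition Gnp_prob :: "nat \<Rightarrow> real \<Rightarrow> ((nat \<times> nat) set \<Rightarrow> bool) \<Rightarrow> real" where
  "Gnp_prob n p P =
     (\<Sum>E\<in>Pow (all_pairs n).
        if P E then p ^ card E * (1 - p) ^ (card (all_pairs n) - card E) else 0)"

text \<open>A d-dimensional framework on vertices {0..<n}: q i k is the k-th coordinate (k < d)
  of vertex i. Squared Euclidean distance in R^d.\<close>
definition sqd :: "nat \<Rightarrow> (nat \<Rightarrow> real) \<Rightarrow> (nat \<Rightarrow> real) \<Rightarrow> real" where
  "sqd d a b = (\<Sum>k<d. (a k - b k)^2)"

text \<open>Genericity: the coordinates q i k (i < n, k < d) are algebraically independent over Q,
  i.e. no nonzero rational polynomial in the variables indexed by {..<n} \<times> {..<d} vanishes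
  at them. A polynomial is a finite set M of distinct monomials (exponent vectors supported on
  the index set) with rational coefficients c.\<close>
definition generic_fw :: "nat \<Rightarrow> nat \<Rightarrow> (nat \<Rightarrow> nat \<Rightarrow> real) \<Rightarrow> bool" where
  "generic_fw n d q \<longleftrightarrow>
     (\<forall>(M :: (nat \<times> nat \<Rightarrow> nat) set) (c :: (nat \<times> nat \<Rightarrow> nat) \<Rightarrow> rat).
        finite M \<longrightarrow>
        (\<forall>\<alpha>\<in>M. \<forall>ik. ik \<notin> {..<n} \<times> {..<d} \<longrightarrow> \<alpha> ik = 0) \<longrightarrow>
        (\<Sum>\<alpha>\<in>M. of_rat (c \<alpha>) * (\<Prod>ik\<in>{..<n} \<times> {..<d}. q (fst ik) (snd ik) ^ \<alpha> ik)) = 0 \<longrightarrow>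
        (\<forall>\<alpha>\<in>M. c \<alpha> = 0))"

definition rigid_fw :: "nat \<Rightarrow> nat \<Rightarrow> (nat \<times> nat) set \<Rightarrow> (nat \<Rightarrow> nat \<Rightarrow> real) \<Rightarrow> bool" where
  "rigid_fw n d E q \<longleftrightarrow>
     \<not> (\<exists>x :: real \<Rightarrow> nat \<Rightarrow> nat \<Rightarrow> real.
          (\<forall>i<n. \<forall>k<d. continuous_on {0..1} (\<lambda>t. x t i k)) \<and>
          (\<forall>i<n. \<forall>k<d. x 0 i k = q i k) \<and>
          (\<forall>t\<in>{0..1}. \<forall>(i, j)\<in>E. sqd d (x t i) (x t j) = sqd d (q i) (q j)) \<and>
          (\<exists>t\<in>{0..1}. \<exists>i<n. \<exists>j<n. sqd d (x t i) (x t j) \<noteq> sqd d (q i) (q j)))"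

definition graph_rigid :: "nat \<Rightarrow> nat \<Rightarrow> (nat \<times> nat) set \<Rightarrow> bool" where
  "graph_rigid n d E \<longleftrightarrow> (\<exists>q. generic_fw n d q \<and> rigid_fw n d E q)"

end

theory Submission
  imports Defs "HOL-Analysis.Continuum_Not_Denumerable" "HOL-Analysis.Connected"
    "HOL-Analysis.Elementary_Metric_Spaces" "HOL-Real_Asymp.Real_Asymp"
    "Jordan_Normal_Form.Determinant"
begin

text \<open>
  If two vertices x, y of a graph have a set W of common neighbours spanning at least d |W| edges,
  then in every generic framework the bar xy is infinitesimally implied by the bars of the graph. A count of
  unknowns gives a nonzero symmetric matrix \<open>\<Omega>\<close>, supported on the diagonal and the edges inside W, with
  \<open>\<Sum>\<^sub>j \<Omega> i j (q j - q x) = 0\<close>. Sliding the vertices i of W by \<open>s \<sigma> i\<close> along the direction xy keeps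
  \<open>\<Omega>\<close> usable, and a motion that stretches only xy would force
  \<open>s (\<Sum> \<Omega> i j \<sigma> i) = s\<^sup>2 (\<Sum> \<Omega> i j \<sigma> i \<sigma> j)\<close> for almost all s, which fails for a suitable \<open>\<sigma>\<close>.
  In G(n,p) any two vertices have linearly many common neighbours and every linearly large
  vertex set spans quadratically many edges, so all pairs are implied when \<open>d \<le> \<epsilon> n\<close>.

  Infinitesimal rigidity gives rigidity because two frameworks y and z have equal length of a bar iff
  y - z does not stretch that bar in the midpoint framework (y + z) / 2.
\<close>

section \<open>Rational polynomials in the coordinates and generic frameworks\<close>

definition monval :: "nat \<Rightarrow> nat \<Rightarrow> (nat \<times> nat \<Rightarrow> nat) \<Rightarrow> (nat \<Rightarrow> nat \<Rightarrow> real) \<Rightarrow> real" where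
  "monval n d \<alpha> q = (\<Prod>ik\<in>{..<n} \<times> {..<d}. q (fst ik) (snd ik) ^ \<alpha> ik)"

definition supported :: "nat \<Rightarrow> nat \<Rightarrow> (nat \<times> nat \<Rightarrow> nat) \<Rightarrow> bool" where
  "supported n d \<alpha> \<longleftrightarrow> (\<forall>ik. ik \<notin> {..<n} \<times> {..<d} \<longrightarrow> \<alpha> ik = 0)"

text \<open>Monomials are kept distinct, as in \<open>generic_fw\<close>, so that genericity applies
  to the coefficients. The polynomial is held as a function, so that closure under sums and products
  can be used on determinants.\<close>

definition polyfun :: "nat \<Rightarrow> nat \<Rightarrow> ((nat \<Rightarrow> nat \<Rightarrow> real) \<Rightarrow> real) \<Rightarrow> bool" where
  "polyfun n d f \<longleftrightarrow> (\<exists>M c. finite M \<and> (\<forall>\<alpha>\<in>M. supported n d \<alpha>) \<and>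
     f = (\<lambda>q. \<Sum>\<alpha>\<in>M. of_rat (c \<alpha>) * monval n d \<alpha> q))"

text \<open>Monomials may collide in a sum or product, so equal ones are collected by adding their
  coefficients.\<close>

lemma polyfunI:
  fixes J :: "'j set"
  assumes J: "finite J" and a: "\<And>j. j \<in> J \<Longrightarrow> supported n d (a j)"
    and f: "\<And>q. f q = (\<Sum>j\<in>J. of_rat (c j) * monval n d (a j) q)"
  shows "polyfun n d f"
proof -
  let ?c = "\<lambda>\<alpha>. \<Sum>j\<in>{j\<in>J. a j = \<alpha>}. c j"
  have "f q = (\<Sum>\<alpha>\<in>a ` J. of_rat (?c \<alpha>) * monval n d \<alpha> q)" for q
  proof -
    have "f q = (\<Sum>\<alpha>\<in>a ` J. \<Sum>j\<in>{j\<in>J. a j = \<alpha>}. of_rat (c j) * monval n d (a j) q)"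
      unfolding f by (rule sum.image_gen[OF J])
    also have "\<dots> = (\<Sum>\<alpha>\<in>a ` J. of_rat (?c \<alpha>) * monval n d \<alpha> q)"
      by (intro sum.cong refl) (simp add: of_rat_sum sum_distrib_right)
    finally show ?thesis .
  qed
  with J a show ?thesis unfolding polyfun_def
    by (intro exI[of _ "a ` J"] exI[of _ ?c]) auto
qed

lemma polyfun_of_rat: "polyfun n d (\<lambda>q. of_rat r)"
  by (rule polyfunI[where J = "{()}" and a = "\<lambda>_ _. 0" and c = "\<lambda>_. r"]) (auto simp: monval_def supported_def)

lemma polyfun_of_int: "polyfun n d (\<lambda>q. of_int r)"
  using polyfun_of_rat[of n d "of_int r"] by simp

lemma polyfun_coord:
  assumes "i < n" "k < d" shows "polyfun n d (\<lambda>q. q i k)"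
proof (rule polyfunI[where J = "{()}" and a = "\<lambda>_ ik. if ik = (i, k) then 1 else 0" and c = "\<lambda>_. 1"])
  fix q :: "nat \<Rightarrow> nat \<Rightarrow> real"
  have "monval n d (\<lambda>ik. if ik = (i, k) then 1 else 0) q =
      (\<Prod>ik\<in>{..<n} \<times> {..<d}. if ik = (i, k) then q i k else 1)"
    unfolding monval_def by (intro prod.cong) auto
  also have "\<dots> = q i k" using assms by (subst prod.delta) auto
  finally show "q i k = (\<Sum>j\<in>{()}. of_rat 1 * monval n d (\<lambda>ik. if ik = (i, k) then 1 else 0) q)" by simp
qed (use assms in \<open>auto simp: supported_def\<close>)

lemma polyfun_add:
  assumes "polyfun n d f" "polyfun n d g" shows "polyfun n d (\<lambda>q. f q + g q)"
proof -
  from assms(1) obtain M c where 1: "finite M" "\<And>\<alpha>. \<alpha> \<in> M \<Longrightarrow> supported n d \<alpha>"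
     "f = (\<lambda>q. \<Sum>\<alpha>\<in>M. of_rat (c \<alpha>) * monval n d \<alpha> q)" unfolding polyfun_def by blast
  from assms(2) obtain M' c' where 2: "finite M'" "\<And>\<alpha>. \<alpha> \<in> M' \<Longrightarrow> supported n d \<alpha>"
     "g = (\<lambda>q. \<Sum>\<alpha>\<in>M'. of_rat (c' \<alpha>) * monval n d \<alpha> q)" unfolding polyfun_def by blast
  show ?thesis
    by (rule polyfunI[where J = "M <+> M'" and a = "case_sum id id" and c = "case_sum c c'"])
      (use 1 2 in \<open>auto simp: sum.Plus\<close>)
qed

lemma monval_mult: "monval n d (\<lambda>ik. \<alpha> ik + \<beta> ik) q = monval n d \<alpha> q * monval n d \<beta> q"
  by (simp add: monval_def power_add prod.distrib)

lemma supported_add: "supported n d \<alpha> \<Longrightarrow> supported n d \<beta> \<Longrightarrow> supported n d (\<lambda>ik. \<alpha> ik + \<beta> ik)"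
  by (simp add: supported_def)

lemma polyfun_mult:
  assumes "polyfun n d f" "polyfun n d g" shows "polyfun n d (\<lambda>q. f q * g q)"
proof -
  from assms(1) obtain M c where 1: "finite M" "\<And>\<alpha>. \<alpha> \<in> M \<Longrightarrow> supported n d \<alpha>"
     "f = (\<lambda>q. \<Sum>\<alpha>\<in>M. of_rat (c \<alpha>) * monval n d \<alpha> q)" unfolding polyfun_def by blast
  from assms(2) obtain M' c' where 2: "finite M'" "\<And>\<alpha>. \<alpha> \<in> M' \<Longrightarrow> supported n d \<alpha>"
     "g = (\<lambda>q. \<Sum>\<alpha>\<in>M'. of_rat (c' \<alpha>) * monval n d \<alpha> q)" unfolding polyfun_def by blast
  show ?thesis
    by (rule polyfunI[where J = "M \<times> M'" and a = "\<lambda>(\<alpha>, \<beta>) ik. \<alpha> ik + \<beta> ik" and c = "\<lambda>(\<alpha>, \<beta>). c \<alpha> * c' \<beta>"])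
      (use 1 2 in \<open>auto simp: sum_product sum.cartesian_product monval_mult of_rat_mult intro!: supported_add sum.cong\<close>)
qed

lemma polyfun_diff:
  assumes "polyfun n d f" "polyfun n d g" shows "polyfun n d (\<lambda>q. f q - g q)"
  using polyfun_add[OF assms(1) polyfun_mult[OF polyfun_of_int[of _ _ "-1"] assms(2)]] by simp

lemma polyfun_sum:
  assumes "\<And>a. a \<in> A \<Longrightarrow> polyfun n d (f a)" shows "polyfun n d (\<lambda>q. \<Sum>a\<in>A. f a q)"
  using assms
proof (induction A rule: infinite_finite_induct)
  case (insert x F) then show ?case by (simp add: polyfun_add)
qed (use polyfun_of_int[of n d 0] in auto)

lemma polyfun_prod:
  assumes "\<And>a. a \<in> A \<Longrightarrow> polyfun n d (f a)" shows "polyfun n d (\<lambda>q. \<Prod>a\<in>A. f a q)"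
  using assms
proof (induction A rule: infinite_finite_induct)
  case (insert x F) then show ?case by (simp add: polyfun_mult)
qed (use polyfun_of_int[of n d 1] in auto)

text \<open>Algebraic independence forces all coefficients to vanish, so one zero at a generic
  framework is a zero everywhere. This carries dependence of bars from \<open>q\<close> to
  frameworks that need not be generic.\<close>

lemma generic_fw_polyfun_zero:
  assumes "generic_fw n d q" "polyfun n d f" "f q = 0" shows "f q' = 0"
proof -
  from assms(2) obtain M c where 1: "finite M" "\<And>\<alpha>. \<alpha> \<in> M \<Longrightarrow> supported n d \<alpha>"
     "f = (\<lambda>q. \<Sum>\<alpha>\<in>M. of_rat (c \<alpha>) * monval n d \<alpha> q)" unfolding polyfun_def by blast
  have "\<forall>\<alpha>\<in>M. c \<alpha> = 0" using assms(1,3) 1 unfolding generic_fw_def monval_def supported_def by blast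
  then show ?thesis by (simp add: 1(3))
qed

text \<open>Along a line the polynomial becomes univariate, so nonvanishing at \<open>s = 0\<close>
  excludes only finitely many values of \<open>s\<close>.\<close>

lemma polyfun_on_line:
  assumes "polyfun n d f"
  obtains P where "\<And>s. f (\<lambda>i k. q i k + s * h i k) = poly P s"
proof -
  from assms obtain M c where f: "f = (\<lambda>q. \<Sum>\<alpha>\<in>M. of_rat (c \<alpha>) * monval n d \<alpha> q)"
    unfolding polyfun_def by blast
  define P where "P = (\<Sum>\<alpha>\<in>M. [:of_rat (c \<alpha>):] *
     (\<Prod>ik\<in>{..<n} \<times> {..<d}. [:q (fst ik) (snd ik), h (fst ik) (snd ik):] ^ \<alpha> ik))"
  show ?thesis
    by (rule that[of P]) (simp add: f P_def monval_def poly_sum poly_prod)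
qed

lemma polyfun_continuous_on:
  assumes "polyfun n d f" "\<And>i k. i < n \<Longrightarrow> k < d \<Longrightarrow> continuous_on S (\<lambda>t. x t i k)"
  shows "continuous_on S (\<lambda>t. f (x t))"
proof -
  from assms(1) obtain M c where f: "f = (\<lambda>q. \<Sum>\<alpha>\<in>M. of_rat (c \<alpha>) * monval n d \<alpha> q)"
    unfolding polyfun_def by blast
  show ?thesis unfolding f monval_def
    by (intro continuous_intros) (use assms(2) in auto)
qed

text \<open>The countable set of all polynomial values is carried through the induction: it makes the set of
  numbers to be avoided by the next coordinate countable.\<close>
lemma algebraically_independent_reals_exist:
  fixes I :: "'i set"
  assumes "finite I"
  shows "\<exists>(q :: 'i \<Rightarrow> real) A. countable A \<and>
    (\<forall>M (c :: _ \<Rightarrow> rat). finite M \<longrightarrow> (\<forall>\<alpha>\<in>M. \<forall>i. i \<notin> I \<longrightarrow> \<alpha> i = 0) \<longrightarrow>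
       (\<Sum>\<alpha>\<in>M. of_rat (c \<alpha>) * (\<Prod>i\<in>I. q i ^ \<alpha> i)) \<in> A \<and>
       ((\<Sum>\<alpha>\<in>M. of_rat (c \<alpha>) * (\<Prod>i\<in>I. q i ^ \<alpha> i)) = 0 \<longrightarrow> (\<forall>\<alpha>\<in>M. c \<alpha> = 0)))"
  using assms
proof (induction I rule: finite_induct)
  case empty
  have "countable (range (of_rat :: rat \<Rightarrow> real))" by simp
  moreover have "(\<Sum>\<alpha>\<in>M. real_of_rat (c \<alpha>)) \<in> range of_rat \<and> ((\<Sum>\<alpha>\<in>M. real_of_rat (c \<alpha>)) = 0 \<longrightarrow> (\<forall>\<alpha>\<in>M. c \<alpha> = 0))"
    if "\<forall>\<alpha>\<in>M. \<forall>i. \<alpha> i = 0" for M :: "('i \<Rightarrow> nat) set" and c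
  proof -
    \<comment> \<open>The only exponent vector over no variables is zero, so there is at most one
      monomial.\<close>
    have "M \<subseteq> {\<lambda>_. 0}" using that by auto
    then consider "M = {}" | "M = {\<lambda>_. 0}" by blast
    then show ?thesis by cases (auto intro: range_eqI[of _ _ 0])
  qed
  ultimately show ?case by (intro exI[of _ "\<lambda>_. 0"] exI[of _ "range of_rat"]) auto
next
  case (insert j I)
  from insert.IH obtain q :: "'i \<Rightarrow> real" and A where A: "countable A"
    and *: "\<forall>M (c :: _ \<Rightarrow> rat). finite M \<longrightarrow> (\<forall>\<alpha>\<in>M. \<forall>i. i \<notin> I \<longrightarrow> \<alpha> i = 0) \<longrightarrow>
       (\<Sum>\<alpha>\<in>M. of_rat (c \<alpha>) * (\<Prod>i\<in>I. q i ^ \<alpha> i)) \<in> A \<and>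
       ((\<Sum>\<alpha>\<in>M. of_rat (c \<alpha>) * (\<Prod>i\<in>I. q i ^ \<alpha> i)) = 0 \<longrightarrow> (\<forall>\<alpha>\<in>M. c \<alpha> = 0))"
    by (elim exE conjE)
  note IH = *[THEN spec, THEN spec, THEN mp, THEN mp]
  note val = IH[THEN conjunct1] and ind = IH[THEN conjunct2, THEN mp]
  \<comment> \<open>Polynomials in the new coordinate with coefficients in the countable set
    \<open>A\<close>. There are countably many, hence countably many roots of nonzero ones, and
    \<open>x\<close> is chosen outside them all.\<close>
  define Q where "Q = {P :: real poly. \<forall>k. coeff P k \<in> A}"
  have "Q \<subseteq> Poly ` lists A"
  proof
    fix P assume "P \<in> Q"
    then have "coeffs P \<in> lists A" by (auto simp: Q_def coeffs_def)
    then show "P \<in> Poly ` lists A" by (metis Poly_coeffs imageI)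
  qed
  then have Q: "countable Q" using A by (meson countable_image countable_lists countable_subset)
  have "countable (\<Union>P\<in>Q - {0}. {x. poly P x = 0})"
    using Q by (intro countable_UN) (auto intro: countable_finite poly_roots_finite)
  then obtain x where x: "x \<notin> (\<Union>P\<in>Q - {0}. {x. poly P x = 0})"
    using uncountable_UNIV_real by (metis UNIV_eq_I)
  define q' where "q' = q(j := x)"
  have main: "(\<Sum>\<alpha>\<in>M. of_rat (c \<alpha>) * (\<Prod>i\<in>insert j I. q' i ^ \<alpha> i)) \<in> (\<lambda>P. poly P x) ` Q \<and>
       ((\<Sum>\<alpha>\<in>M. of_rat (c \<alpha>) * (\<Prod>i\<in>insert j I. q' i ^ \<alpha> i)) = 0 \<longrightarrow> (\<forall>\<alpha>\<in>M. c \<alpha> = 0))"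
    if M: "finite M" "\<forall>\<alpha>\<in>M. \<forall>i. i \<notin> insert j I \<longrightarrow> \<alpha> i = 0" for M and c :: "_ \<Rightarrow> rat"
  proof -
    define P where "P = (\<Sum>\<alpha>\<in>M. monom (of_rat (c \<alpha>) * (\<Prod>i\<in>I. q i ^ \<alpha> i)) (\<alpha> j))"
    have eq: "(\<Sum>\<alpha>\<in>M. of_rat (c \<alpha>) * (\<Prod>i\<in>insert j I. q' i ^ \<alpha> i)) = poly P x"
    proof -
      have "(\<Prod>i\<in>insert j I. q' i ^ \<alpha> i) = x ^ \<alpha> j * (\<Prod>i\<in>I. q i ^ \<alpha> i)" for \<alpha> :: "'i \<Rightarrow> nat"
      proof -
        have "(\<Prod>i\<in>I. q' i ^ \<alpha> i) = (\<Prod>i\<in>I. q i ^ \<alpha> i)"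
          using insert.hyps by (intro prod.cong) (auto simp: q'_def)
        then show ?thesis using insert.hyps by (simp add: q'_def)
      qed
      then show ?thesis by (simp add: P_def poly_sum poly_monom mult_ac)
    qed
    \<comment> \<open>Monomials of degree \<open>k\<close> in \<open>j\<close>, with that exponent
      erased to make them monomials over \<open>I\<close>. Putting \<open>k\<close> back recovers
      the original monomial, so erasing is injective.\<close>
    let ?M = "\<lambda>k. (\<lambda>\<alpha>. \<alpha>(j := 0)) ` {\<alpha>\<in>M. \<alpha> j = k}"
    let ?c = "\<lambda>k \<beta>. c (\<beta>(j := k))"
    have co: "coeff P k = (\<Sum>\<beta>\<in>?M k. of_rat (?c k \<beta>) * (\<Prod>i\<in>I. q i ^ \<beta> i))" for k
    proof -
      have inj: "inj_on (\<lambda>\<alpha>. \<alpha>(j := 0)) {\<alpha>\<in>M. \<alpha> j = k}"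
        by (rule inj_onI) (metis (mono_tags, lifting) fun_upd_triv fun_upd_upd mem_Collect_eq)
      have "coeff P k = (\<Sum>\<alpha>\<in>M. if \<alpha> j = k then of_rat (c \<alpha>) * (\<Prod>i\<in>I. q i ^ \<alpha> i) else 0)"
        by (simp add: P_def coeff_sum)
      also have "\<dots> = (\<Sum>\<alpha>\<in>{\<alpha>\<in>M. \<alpha> j = k}. of_rat (c \<alpha>) * (\<Prod>i\<in>I. q i ^ \<alpha> i))"
        using M(1) by (simp add: sum.inter_filter)
      also have "\<dots> = (\<Sum>\<beta>\<in>?M k. of_rat (?c k \<beta>) * (\<Prod>i\<in>I. q i ^ \<beta> i))"
        unfolding sum.reindex[OF inj]
      proof (intro sum.cong refl)
        fix \<alpha> assume "\<alpha> \<in> {\<alpha>\<in>M. \<alpha> j = k}"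
        then have "\<alpha>(j := 0, j := k) = \<alpha>" by auto
        moreover have "(\<Prod>i\<in>I. q i ^ (\<alpha>(j := 0)) i) = (\<Prod>i\<in>I. q i ^ \<alpha> i)"
          using insert.hyps by (intro prod.cong) auto
        ultimately show "real_of_rat (c \<alpha>) * (\<Prod>i\<in>I. q i ^ \<alpha> i) =
           ((\<lambda>\<beta>. of_rat (?c k \<beta>) * (\<Prod>i\<in>I. q i ^ \<beta> i)) \<circ> (\<lambda>\<alpha>. \<alpha>(j := 0))) \<alpha>" by simp
      qed
      finally show ?thesis .
    qed
    have M': "finite (?M k)" "\<forall>\<alpha>\<in>?M k. \<forall>i. i \<notin> I \<longrightarrow> \<alpha> i = 0" for k
      using M by auto
    have "P \<in> Q" unfolding Q_def using val[OF M'] co by simp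
    moreover have "\<forall>\<alpha>\<in>M. c \<alpha> = 0" if "poly P x = 0"
    proof
      fix \<alpha> assume \<alpha>: "\<alpha> \<in> M"
      have "P = 0" using x \<open>P \<in> Q\<close> that by auto
      then have "(\<Sum>\<beta>\<in>?M (\<alpha> j). of_rat (?c (\<alpha> j) \<beta>) * (\<Prod>i\<in>I. q i ^ \<beta> i)) = 0" using co[of "\<alpha> j"] by simp
      from ind[OF M' this] \<alpha> have "?c (\<alpha> j) (\<alpha>(j := 0)) = 0" by blast
      then show "c \<alpha> = 0" by simp
    qed
    ultimately show ?thesis unfolding eq by blast
  qed
  have "countable ((\<lambda>P. poly P x) ` Q)" using Q by simp
  with main show ?case by (intro exI[of _ q'] exI[of _ "(\<lambda>P. poly P x) ` Q"] conjI allI impI) simp_all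
qed

lemma generic_fw_exists: "\<exists>q. generic_fw n d q"
proof -
  have "finite ({..<n} \<times> {..<d})" by simp
  from algebraically_independent_reals_exist[OF this] obtain q :: "nat \<times> nat \<Rightarrow> real" and A where
    *: "\<forall>M (c :: _ \<Rightarrow> rat). finite M \<longrightarrow> (\<forall>\<alpha>\<in>M. \<forall>i. i \<notin> {..<n} \<times> {..<d} \<longrightarrow> \<alpha> i = 0) \<longrightarrow>
      (\<Sum>\<alpha>\<in>M. of_rat (c \<alpha>) * (\<Prod>i\<in>{..<n} \<times> {..<d}. q i ^ \<alpha> i)) \<in> A \<and>
      ((\<Sum>\<alpha>\<in>M. of_rat (c \<alpha>) * (\<Prod>i\<in>{..<n} \<times> {..<d}. q i ^ \<alpha> i)) = 0 \<longrightarrow> (\<forall>\<alpha>\<in>M. c \<alpha> = 0))"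
    by (elim exE conjE)
  show ?thesis
    unfolding generic_fw_def
  proof (intro exI[of _ "\<lambda>i k. q (i, k)"] allI impI)
    fix M :: "(nat \<times> nat \<Rightarrow> nat) set" and c :: "_ \<Rightarrow> rat"
    assume "finite M" "\<forall>\<alpha>\<in>M. \<forall>ik. ik \<notin> {..<n} \<times> {..<d} \<longrightarrow> \<alpha> ik = 0"
      and "(\<Sum>\<alpha>\<in>M. of_rat (c \<alpha>) * (\<Prod>ik\<in>{..<n} \<times> {..<d}. q (fst ik, snd ik) ^ \<alpha> ik)) = 0"
    then show "\<forall>\<alpha>\<in>M. c \<alpha> = 0" using *[THEN spec[of _ M], THEN spec[of _ c]] by simp
  qed
qed

section \<open>Rigidity rows and their Gram determinants\<close>

text \<open>The row of the rigidity matrix, shaped as a velocity field so that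
  \<open>stretch\<close> can be applied to it. A loop gets the zero row.\<close>

definition edge_row :: "(nat \<Rightarrow> nat \<Rightarrow> real) \<Rightarrow> nat \<times> nat \<Rightarrow> nat \<Rightarrow> nat \<Rightarrow> real" where
  "edge_row q e i k = (of_bool (i = fst e) - of_bool (i = snd e)) * (q (fst e) k - q (snd e) k)"

text \<open>Half the derivative of the squared length of the bar when the vertices move with
  velocities \<open>h\<close>.\<close>

definition stretch :: "nat \<Rightarrow> (nat \<Rightarrow> nat \<Rightarrow> real) \<Rightarrow> nat \<times> nat \<Rightarrow> (nat \<Rightarrow> nat \<Rightarrow> real) \<Rightarrow> real" where
  "stretch d q e h = (\<Sum>k<d. (q (fst e) k - q (snd e) k) * (h (fst e) k - h (snd e) k))"

lemma stretch_sum: "stretch d q e (\<lambda>i k. \<Sum>a\<in>A. c a * f a i k) = (\<Sum>a\<in>A. c a * stretch d q e (f a))"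
proof -
  have "stretch d q e (\<lambda>i k. \<Sum>a\<in>A. c a * f a i k) =
      (\<Sum>k<d. \<Sum>a\<in>A. c a * ((q (fst e) k - q (snd e) k) * (f a (fst e) k - f a (snd e) k)))"
    unfolding stretch_def by (intro sum.cong refl)
      (simp add: sum_subtractf[symmetric] sum_distrib_left algebra_simps)
  also have "\<dots> = (\<Sum>a\<in>A. c a * stretch d q e (f a))"
    unfolding stretch_def sum_distrib_left by (rule sum.swap)
  finally show ?thesis .
qed

lemma stretch_row:
  assumes "fst e < n" "snd e < n"
  shows "stretch d q e h = (\<Sum>i<n. \<Sum>k<d. edge_row q e i k * h i k)"
proof -
  have "(\<Sum>i<n. \<Sum>k<d. edge_row q e i k * h i k) =
      (\<Sum>k<d. \<Sum>i<n. edge_row q e i k * h i k)" by (rule sum.swap)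
  also have "\<dots> = (\<Sum>k<d. (q (fst e) k - q (snd e) k) * (h (fst e) k - h (snd e) k))"
  proof (intro sum.cong refl)
    fix k
    have "(\<Sum>i<n. edge_row q e i k * h i k) = (q (fst e) k - q (snd e) k) *
        ((\<Sum>i<n. of_bool (i = fst e) * h i k) - (\<Sum>i<n. of_bool (i = snd e) * h i k))"
      unfolding edge_row_def sum_subtractf[symmetric] sum_distrib_left
      by (intro sum.cong refl) (simp add: algebra_simps)
    also have "(\<Sum>i<n. of_bool (i = fst e) * h i k) = h (fst e) k"
      using assms by (simp add: of_bool_def if_distrib[of "\<lambda>x. x * _"] cong: if_cong)
    also have "(\<Sum>i<n. of_bool (i = snd e) * h i k) = h (snd e) k"
      using assms by (simp add: of_bool_def if_distrib[of "\<lambda>x. x * _"] cong: if_cong)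
    finally show "(\<Sum>i<n. edge_row q e i k * h i k) =
      (q (fst e) k - q (snd e) k) * (h (fst e) k - h (snd e) k)" .
  qed
  finally show ?thesis by (simp add: stretch_def)
qed

text \<open>By \<open>stretch_row\<close> the entries are inner products of rows of the rigidity
  matrix; \<open>stretch\<close> expresses them without mention of the number of vertices.\<close>

definition gram_mat :: "nat \<Rightarrow> (nat \<times> nat) list \<Rightarrow> (nat \<Rightarrow> nat \<Rightarrow> real) \<Rightarrow> real mat" where
  "gram_mat d es q = mat (length es) (length es) (\<lambda>(a, b). stretch d q (es ! a) (edge_row q (es ! b)))"

text \<open>Nonvanishing of this determinant expresses linear independence of the rows by a polynomial
  condition (hence decided by genericity) that depends on the squared distances only (hence is
  constant along congruent frameworks).\<close>
definition gram :: "nat \<Rightarrow> (nat \<times> nat) list \<Rightarrow> (nat \<Rightarrow> nat \<Rightarrow> real) \<Rightarrow> real" where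
  "gram d es q = det (gram_mat d es q)"

lemma gram_mat_carrier: "gram_mat d es q \<in> carrier_mat (length es) (length es)"
  by (simp add: gram_mat_def)

text \<open>A coefficient vector is read as a velocity field combining the rows, so kernel vectors
  and solutions of linear systems become motions with known stretches.\<close>

lemma gram_mat_mult_vec:
  assumes "v \<in> carrier_vec (length es)" "a < length es"
  shows "(gram_mat d es q *\<^sub>v v) $ a = stretch d q (es ! a) (\<lambda>i k. \<Sum>b<length es. v $ b * edge_row q (es ! b) i k)"
  using assms unfolding stretch_sum
  by (auto simp: gram_mat_def scalar_prod_def mult.commute lessThan_atLeast0 intro!: sum.cong)

lemma polyfun_of_bool: "polyfun n d (\<lambda>q. of_bool b)"
  using polyfun_of_int[of n d "of_bool b"] by simp

lemma polyfun_gram_entry: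
  assumes "fst e < n" "snd e < n" "fst f < n" "snd f < n"
  shows "polyfun n d (\<lambda>q. stretch d q e (edge_row q f))"
  unfolding stretch_def edge_row_def
  by (intro polyfun_sum polyfun_mult polyfun_diff polyfun_coord polyfun_of_bool assms) auto

lemma polyfun_gram:
  assumes "set es \<subseteq> {..<n} \<times> {..<n}"
  shows "polyfun n d (gram d es)"
proof -
  have e: "fst (es ! a) < n \<and> snd (es ! a) < n" if "a < length es" for a
    using assms nth_mem[OF that] by auto
  have "gram d es = (\<lambda>q. \<Sum>\<pi>\<in>{\<pi>. \<pi> permutes {0..<length es}}.
      of_int (sign \<pi>) * (\<Prod>a=0..<length es. stretch d q (es ! a) (edge_row q (es ! \<pi> a))))"
    unfolding gram_def det_def'[OF gram_mat_carrier]
    by (intro ext sum.cong refl arg_cong2[of _ _ _ _ "(*)"] prod.cong)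
      (auto simp: gram_mat_def permutes_in_image)
  moreover have "polyfun n d \<dots>"
    by (intro polyfun_sum polyfun_mult polyfun_prod polyfun_of_int polyfun_gram_entry)
      (use e in \<open>auto simp: permutes_in_image\<close>)
  ultimately show ?thesis by simp
qed

text \<open>Polarisation; it is what makes \<open>gram\<close> a function of the squared
  distances.\<close>

lemma dot_by_sqd:
  "(\<Sum>k<d. (q u k - q v k) * (q u' k - q v' k)) =
   (sqd d (q u) (q v') + sqd d (q v) (q u') - sqd d (q u) (q u') - sqd d (q v) (q v')) / 2"
  unfolding sqd_def sum.distrib[symmetric] sum_subtractf[symmetric] sum_divide_distrib
  by (intro sum.cong refl) (simp add: power2_eq_square field_simps)

lemma stretch_row_by_sqd:
  "stretch d q e (edge_row q f) =
    (of_bool (fst e = fst f) - of_bool (fst e = snd f) - of_bool (snd e = fst f) + of_bool (snd e = snd f)) *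
    ((sqd d (q (fst e)) (q (snd f)) + sqd d (q (snd e)) (q (fst f))
      - sqd d (q (fst e)) (q (fst f)) - sqd d (q (snd e)) (q (snd f))) / 2)"
  unfolding dot_by_sqd[symmetric] stretch_def edge_row_def sum_distrib_left
  by (intro sum.cong refl) (simp add: algebra_simps)

lemma gram_cong_sqd:
  assumes "set es \<subseteq> {..<n} \<times> {..<n}"
    and "\<And>u v. u < n \<Longrightarrow> v < n \<Longrightarrow> sqd d (q u) (q v) = sqd d (q' u) (q' v)"
  shows "gram d es q = gram d es q'"
proof -
  have e: "fst (es ! a) < n \<and> snd (es ! a) < n" if "a < length es" for a
    using assms nth_mem[OF that] by auto
  have "gram_mat d es q = gram_mat d es q'"
    unfolding gram_mat_def stretch_row_by_sqd by (rule cong_mat) (auto simp: e assms(2))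
  then show ?thesis by (simp add: gram_def)
qed

text \<open>The combination \<open>h\<close> of the rows with coefficients \<open>v\<close> has
  squared norm equal to the quadratic form of the Gram matrix at \<open>v\<close>. If the matrix
  kills \<open>v\<close> this is zero, and over the reals \<open>h\<close> itself vanishes.\<close>

lemma gram_zero_iff:
  assumes es: "set es \<subseteq> {..<n} \<times> {..<n}"
  shows "gram d es q = 0 \<longleftrightarrow> (\<exists>v \<in> carrier_vec (length es). v \<noteq> 0\<^sub>v (length es) \<and>
    (\<forall>i<n. \<forall>k<d. (\<Sum>b<length es. v $ b * edge_row q (es ! b) i k) = 0))"
proof -
  let ?m = "length es"
  have e: "fst (es ! a) < n \<and> snd (es ! a) < n" if "a < ?m" for a
    using assms nth_mem[OF that] by auto
  have "gram_mat d es q *\<^sub>v v = 0\<^sub>v ?m \<longleftrightarrow> (\<forall>i<n. \<forall>k<d. (\<Sum>b<?m. v $ b * edge_row q (es ! b) i k) = 0)"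
    if v: "v \<in> carrier_vec ?m" for v
  proof
    let ?h = "\<lambda>i k. \<Sum>b<?m. v $ b * edge_row q (es ! b) i k"
    assume 0: "gram_mat d es q *\<^sub>v v = 0\<^sub>v ?m"
    have "(\<Sum>i<n. \<Sum>k<d. ?h i k * ?h i k) =
        (\<Sum>i<n. \<Sum>k<d. \<Sum>a<?m. v $ a * (edge_row q (es ! a) i k * ?h i k))"
      by (simp add: sum_distrib_right mult.assoc)
    also have "\<dots> = (\<Sum>i<n. \<Sum>a<?m. \<Sum>k<d. v $ a * (edge_row q (es ! a) i k * ?h i k))"
      by (intro sum.cong refl sum.swap)
    also have "\<dots> = (\<Sum>a<?m. \<Sum>i<n. \<Sum>k<d. v $ a * (edge_row q (es ! a) i k * ?h i k))"
      by (rule sum.swap)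
    also have "\<dots> = (\<Sum>a<?m. v $ a * stretch d q (es ! a) ?h)"
    proof (intro sum.cong refl)
      fix a assume "a \<in> {..<?m}"
      then show "(\<Sum>i<n. \<Sum>k<d. v $ a * (edge_row q (es ! a) i k * ?h i k)) = v $ a * stretch d q (es ! a) ?h"
        using stretch_row[of "es ! a" n d q ?h] e by (simp only: sum_distrib_left lessThan_iff)
    qed
    also have "\<dots> = (\<Sum>a<?m. v $ a * (gram_mat d es q *\<^sub>v v) $ a)"
      using v by (intro sum.cong refl) (simp add: gram_mat_mult_vec)
    also have "\<dots> = 0" by (simp add: 0)
    finally have "(\<Sum>i<n. \<Sum>k<d. ?h i k * ?h i k) = 0" .
    then show "\<forall>i<n. \<forall>k<d. ?h i k = 0"
      by (simp add: sum_nonneg_eq_0_iff sum_nonneg)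
  next
    assume "\<forall>i<n. \<forall>k<d. (\<Sum>b<?m. v $ b * edge_row q (es ! b) i k) = 0"
    then have "(gram_mat d es q *\<^sub>v v) $ a = 0" if "a < ?m" for a
      using e[OF that] that v by (simp add: gram_mat_mult_vec stretch_row[of _ n])
    then show "gram_mat d es q *\<^sub>v v = 0\<^sub>v ?m"
      by (intro eq_vecI) (auto simp: gram_mat_def)
  qed
  then show ?thesis
    unfolding gram_def det_0_iff_vec_prod_zero_field[OF gram_mat_carrier] by blast
qed

text \<open>Independence of \<open>es\<close> makes the coefficient of \<open>e\<close> in a linear
  relation nonzero, so the row of \<open>e\<close> is a combination of the rows of
  \<open>es\<close>, and its stretch under \<open>h\<close> is a combination of zeros.\<close>

lemma stretch_eq_zero_if_dependent:
  assumes es: "set es \<subseteq> {..<n} \<times> {..<n}" and e: "e \<in> {..<n} \<times> {..<n}"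
    and ind: "gram d es q \<noteq> 0" and dep: "gram d (es @ [e]) q = 0"
    and h: "\<And>f. f \<in> set es \<Longrightarrow> stretch d q f h = 0"
  shows "stretch d q e h = 0"
proof -
  let ?m = "length es"
  have es': "set (es @ [e]) \<subseteq> {..<n} \<times> {..<n}" using es e by auto
  obtain v where v: "v \<in> carrier_vec (Suc ?m)" "v \<noteq> 0\<^sub>v (Suc ?m)"
    and z: "\<And>i k. i < n \<Longrightarrow> k < d \<Longrightarrow> (\<Sum>b<Suc ?m. v $ b * edge_row q ((es @ [e]) ! b) i k) = 0"
    using dep unfolding gram_zero_iff[OF es'] by auto
  have z': "(\<Sum>b<?m. v $ b * edge_row q (es ! b) i k) + v $ ?m * edge_row q e i k = 0" if "i < n" "k < d" for i k
  proof -
    have "(\<Sum>b<?m. v $ b * edge_row q ((es @ [e]) ! b) i k) = (\<Sum>b<?m. v $ b * edge_row q (es ! b) i k)"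
      by (intro sum.cong) (auto simp: nth_append)
    then show ?thesis using z[OF that] by simp
  qed
  have nz: "v $ ?m \<noteq> 0"
  proof
    assume 0: "v $ ?m = 0"
    let ?w = "vec ?m (\<lambda>b. v $ b)"
    have "?w \<noteq> 0\<^sub>v ?m"
    proof
      assume w: "?w = 0\<^sub>v ?m"
      have "v $ b = 0" if "b < Suc ?m" for b
      proof (cases "b < ?m")
        case True
        then have "v $ b = ?w $ b" by simp
        also have "\<dots> = 0" unfolding w using True by simp
        finally show ?thesis .
      next
        case False then show ?thesis using that 0 by (simp add: less_Suc_eq)
      qed
      then have "v = 0\<^sub>v (Suc ?m)" using v(1) by (intro eq_vecI) auto
      then show False using v(2) by simp
    qed
    moreover have "\<forall>i<n. \<forall>k<d. (\<Sum>b<?m. ?w $ b * edge_row q (es ! b) i k) = 0"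
      using z' 0 by simp
    ultimately show False using ind unfolding gram_zero_iff[OF es] by auto
  qed
  have e': "fst (es ! a) < n \<and> snd (es ! a) < n" if "a < ?m" for a
    using es nth_mem[OF that] by auto
  have "v $ ?m * stretch d q e h = (\<Sum>i<n. \<Sum>k<d. (v $ ?m * edge_row q e i k) * h i k)"
    using e by (subst stretch_row[of _ n]) (auto simp: sum_distrib_left mult.assoc)
  also have "\<dots> = (\<Sum>i<n. \<Sum>k<d. - (\<Sum>b<?m. v $ b * edge_row q (es ! b) i k) * h i k)"
    using z' by (intro sum.cong refl arg_cong2[of _ _ _ _ "(*)"]) (smt (verit) lessThan_iff)
  also have "\<dots> = - (\<Sum>i<n. \<Sum>k<d. \<Sum>b<?m. v $ b * (edge_row q (es ! b) i k * h i k))"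
    by (simp add: sum_negf sum_distrib_right mult.assoc)
  also have "(\<Sum>i<n. \<Sum>k<d. \<Sum>b<?m. v $ b * (edge_row q (es ! b) i k * h i k)) =
      (\<Sum>i<n. \<Sum>b<?m. \<Sum>k<d. v $ b * (edge_row q (es ! b) i k * h i k))"
    by (intro sum.cong refl sum.swap)
  also have "\<dots> = (\<Sum>b<?m. \<Sum>i<n. \<Sum>k<d. v $ b * (edge_row q (es ! b) i k * h i k))"
    by (rule sum.swap)
  also have "\<dots> = (\<Sum>b<?m. v $ b * stretch d q (es ! b) h)"
  proof (intro sum.cong refl)
    fix a assume "a \<in> {..<?m}"
    then show "(\<Sum>i<n. \<Sum>k<d. v $ a * (edge_row q (es ! a) i k * h i k)) = v $ a * stretch d q (es ! a) h"
      using stretch_row[of "es ! a" n d q h] e' by (simp only: sum_distrib_left lessThan_iff)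
  qed
  also have "\<dots> = 0" using h by simp
  finally show ?thesis using nz by simp
qed

lemma gram_prefix_nonzero:
  assumes es: "set (es @ [e]) \<subseteq> {..<n} \<times> {..<n}" and ind: "gram d (es @ [e]) q \<noteq> 0"
  shows "gram d es q \<noteq> 0"
proof
  let ?m = "length es"
  have es1: "set es \<subseteq> {..<n} \<times> {..<n}" using es by simp
  assume "gram d es q = 0"
  then obtain v where v: "v \<in> carrier_vec ?m" "v \<noteq> 0\<^sub>v ?m"
    and z: "\<forall>i<n. \<forall>k<d. (\<Sum>b<?m. v $ b * edge_row q (es ! b) i k) = 0"
    unfolding gram_zero_iff[OF es1] by auto
  let ?w = "vec (Suc ?m) (\<lambda>b. if b < ?m then v $ b else 0)"
  have "?w \<noteq> 0\<^sub>v (Suc ?m)"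
  proof
    assume w: "?w = 0\<^sub>v (Suc ?m)"
    have "v $ b = 0" if "b < ?m" for b
      using arg_cong[OF w, of "\<lambda>x. x $ b"] that by simp
    then have "v = 0\<^sub>v ?m" using v(1) by (intro eq_vecI) auto
    then show False using v(2) by simp
  qed
  moreover have "\<forall>i<n. \<forall>k<d. (\<Sum>b<Suc ?m. ?w $ b * edge_row q ((es @ [e]) ! b) i k) = 0"
  proof (intro allI impI)
    fix i k assume "i < n" "k < d"
    have "(\<Sum>b<?m. ?w $ b * edge_row q ((es @ [e]) ! b) i k) = (\<Sum>b<?m. v $ b * edge_row q (es ! b) i k)"
      by (intro sum.cong) (auto simp: nth_append)
    then show "(\<Sum>b<Suc ?m. ?w $ b * edge_row q ((es @ [e]) ! b) i k) = 0"
      using z \<open>i < n\<close> \<open>k < d\<close> by simp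
  qed
  ultimately have "gram d (es @ [e]) q = 0" unfolding gram_zero_iff[OF es]
    by (intro bexI[of _ ?w]) auto
  with ind show False by simp
qed

text \<open>The Gram matrix is invertible, so the last unit vector is the image of some coefficient
  vector; the corresponding combination of rows is the motion sought.\<close>

lemma separating_motion:
  assumes es: "set (es @ [e]) \<subseteq> {..<n} \<times> {..<n}" and ind: "gram d (es @ [e]) q \<noteq> 0"
  obtains h where "\<And>f. f \<in> set es \<Longrightarrow> stretch d q f h = 0" "stretch d q e h = 1"
proof -
  let ?m = "length (es @ [e])" let ?G = "gram_mat d (es @ [e]) q"
  have "?G \<in> Units (ring_mat TYPE(real) ?m ())"
    by (rule det_non_zero_imp_unit[OF gram_mat_carrier]) (use ind in \<open>simp add: gram_def\<close>)
  then obtain B where B: "B \<in> carrier_mat ?m ?m" "?G * B = 1\<^sub>m ?m"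
    unfolding Units_def ring_mat_def by auto
  define u :: "real vec" where "u = unit_vec ?m (length es)"
  define v where "v = B *\<^sub>v u"
  have v: "v \<in> carrier_vec ?m" unfolding v_def by (rule mult_mat_vec_carrier[OF B(1)]) (simp add: u_def)
  have Gv: "?G *\<^sub>v v = u"
    unfolding v_def using B gram_mat_carrier[of d "es @ [e]" q]
    by (subst assoc_mult_mat_vec[symmetric, of _ ?m ?m _ ?m]) (auto simp: u_def)
  let ?h = "\<lambda>i k. \<Sum>b<?m. v $ b * edge_row q ((es @ [e]) ! b) i k"
  have h: "stretch d q ((es @ [e]) ! a) ?h = (if a = length es then 1 else 0)" if "a < ?m" for a
    using gram_mat_mult_vec[OF v that, of d q] that unfolding Gv by (auto simp: u_def unit_vec_def)
  show thesis
  proof (rule that[of ?h])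
    fix f assume "f \<in> set es"
    then obtain a where "a < length es" "f = es ! a" by (auto simp: in_set_conv_nth)
    with h[of a] show "stretch d q f ?h = 0" by (auto simp: nth_append)
  next
    show "stretch d q e ?h = 1" using h[of "length es"] by simp
  qed
qed

section \<open>From infinitesimal to continuous rigidity\<close>

text \<open>A difference of two squares, factored. The identity is exact, not first order, so
  motions that are only continuous can be treated.\<close>

lemma stretch_midpoint:
  "stretch d (\<lambda>i k. (y i k + z i k) / 2) e (\<lambda>i k. y i k - z i k) =
   (sqd d (y (fst e)) (y (snd e)) - sqd d (z (fst e)) (z (snd e))) / 2"
  unfolding stretch_def sqd_def sum_subtractf[symmetric] sum_divide_distrib
  by (intro sum.cong refl) (simp add: power2_eq_square field_simps)

text \<open>The times at which the framework is congruent to \<open>q\<close> form an open and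
  closed subset of the unit interval containing 0. The hypothesis \<open>dep\<close> ranges over all
  \<open>q'\<close> because it is applied at midpoint frameworks, which need not be generic.\<close>

lemma rigid_fw_if_spanning:
  assumes E: "E \<subseteq> {..<n} \<times> {..<n}" and es: "set es \<subseteq> E"
    and ind: "gram d es q \<noteq> 0"
    and dep: "\<And>e q'. e \<in> {..<n} \<times> {..<n} \<Longrightarrow> gram d (es @ [e]) q' = 0"
  shows "rigid_fw n d E q"
  unfolding rigid_fw_def
proof (intro notI, elim exE conjE)
  fix x :: "real \<Rightarrow> nat \<Rightarrow> nat \<Rightarrow> real"
  assume cont: "\<forall>i<n. \<forall>k<d. continuous_on {0..1} (\<lambda>t. x t i k)"
    and start: "\<forall>i<n. \<forall>k<d. x 0 i k = q i k"
    and flex: "\<forall>t\<in>{0..1}. \<forall>(i, j)\<in>E. sqd d (x t i) (x t j) = sqd d (q i) (q j)"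
    and moved: "\<exists>t\<in>{0..1}. \<exists>i<n. \<exists>j<n. sqd d (x t i) (x t j) \<noteq> sqd d (q i) (q j)"
  define F where "F = (\<lambda>t. \<Sum>i<n. \<Sum>j<n. (sqd d (x t i) (x t j) - sqd d (q i) (q j))\<^sup>2)"
  define S where "S = {t \<in> {0..1::real}. F t = 0}"
  have F: "F t = 0 \<longleftrightarrow> (\<forall>i<n. \<forall>j<n. sqd d (x t i) (x t j) = sqd d (q i) (q j))" for t
    unfolding F_def by (auto simp: sum_nonneg_eq_0_iff sum_nonneg)
  have flex_E: "sqd d (x t (fst f)) (x t (snd f)) = sqd d (q (fst f)) (q (snd f))"
    if "t \<in> {0..1}" "f \<in> E" for t f
    using flex that by (cases f) auto
  have es_n: "set es \<subseteq> {..<n} \<times> {..<n}" using E es by blast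
  have "continuous_on {0..1} F"
    unfolding F_def sqd_def by (intro continuous_intros) (use cont in auto)
  then have closed: "closedin (top_of_set {0..1}) S"
    unfolding S_def by (rule continuous_closedin_preimage_constant)
  have "openin (top_of_set {0..1}) S"
    unfolding openin_euclidean_subtopology_iff
  proof (intro conjI ballI)
    show "S \<subseteq> {0..1}" by (auto simp: S_def)
    fix t0 assume t0: "t0 \<in> S"
    \<comment> \<open>At \<open>t = t0\<close> the midpoint is \<open>x t0\<close> itself, where
      \<open>gram\<close> is nonzero by congruence with \<open>q\<close>; by continuity
      \<open>es\<close> stays independent at nearby midpoints.\<close>
    let ?g = "\<lambda>t. gram d es (\<lambda>i k. (x t i k + x t0 i k) / 2)"
    have "?g t0 = gram d es (x t0)" by simp
    also have "\<dots> = gram d es q" using t0 by (intro gram_cong_sqd[OF es_n]) (auto simp: S_def F)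
    finally have g0: "?g t0 \<noteq> 0" using ind by simp
    have cont_g: "continuous_on {0..1} ?g"
      using cont by (intro polyfun_continuous_on[OF polyfun_gram[OF es_n]] continuous_intros) auto
    have t01: "t0 \<in> {0..1}" and pos: "0 < \<bar>?g t0\<bar>" using t0 g0 by (auto simp: S_def)
    obtain \<delta> where \<delta>: "\<delta> > 0"
      and "\<forall>t\<in>{0..1}. dist t t0 < \<delta> \<longrightarrow> dist (?g t) (?g t0) < \<bar>?g t0\<bar>"
      using cont_g[unfolded continuous_on_iff, THEN bspec, OF t01, THEN spec, THEN mp, OF pos] by (elim exE conjE)
    note close = this(2)[THEN bspec, THEN mp]
    show "\<exists>e>0. \<forall>t\<in>{0..1}. dist t t0 < e \<longrightarrow> t \<in> S"
    proof (intro exI[of _ \<delta>] conjI ballI impI \<delta>)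
      fix t :: real assume t: "t \<in> {0..1}" "dist t t0 < \<delta>"
      have g: "?g t \<noteq> 0" using close[OF t] by (auto simp: dist_real_def)
      let ?m = "\<lambda>i k. (x t i k + x t0 i k) / 2" and ?h = "\<lambda>i k. x t i k - x t0 i k"
      \<comment> \<open>Both frameworks have the lengths of \<open>q\<close> on \<open>es\<close>,
        so their difference stretches no bar of \<open>es\<close> at the midpoint, and hence no bar
        at all once \<open>es\<close> spans there.\<close>
      have "stretch d ?m f ?h = 0" if "f \<in> set es" for f
      proof -
        have "f \<in> E" using that es by blast
        then have "sqd d (x t (fst f)) (x t (snd f)) = sqd d (x t0 (fst f)) (x t0 (snd f))"
          using flex_E t(1) t01 by simp
        then show ?thesis unfolding stretch_midpoint by simp
      qed
      then have "stretch d ?m e ?h = 0" if "e \<in> {..<n} \<times> {..<n}" for e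
        by (rule stretch_eq_zero_if_dependent[OF es_n that g dep[OF that]])
      from this[of "(i, j)" for i j] have "sqd d (x t i) (x t j) = sqd d (x t0 i) (x t0 j)"
        if "i < n" "j < n" for i j
        using that unfolding stretch_midpoint by simp
      then show "t \<in> S" using t0 t(1) by (simp add: S_def F)
    qed
  qed
  with closed have "S = {} \<or> S = {0..1}"
    using connected_Icc[of "0::real" 1] unfolding connected_clopen by blast
  moreover have "0 \<in> S"
    using start by (auto simp: S_def F sqd_def intro!: sum.cong)
  ultimately have "S = {0..1}" by blast
  with moved F show False unfolding S_def by blast
qed

section \<open>Implied bars\<close>

text \<open>Gaussian elimination by induction on the equations: one with a nonzero coefficient
  eliminates one unknown.\<close>

lemma homogeneous_system_nontrivial:
  fixes a :: "'q \<Rightarrow> 't \<Rightarrow> real"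
  assumes "finite Q" "finite T" "card Q < card T"
  shows "\<exists>w. (\<exists>t\<in>T. w t \<noteq> 0) \<and> (\<forall>r\<in>Q. (\<Sum>t\<in>T. w t * a r t) = 0)"
  using assms
proof (induction Q arbitrary: T a rule: finite_induct)
  case empty
  then have "T \<noteq> {}" by auto
  then show ?case by (intro exI[of _ "\<lambda>_. 1"]) auto
next
  case (insert r Q)
  show ?case
  proof (cases "\<forall>t\<in>T. a r t = 0")
    case True
    have "card Q < card T" using insert.prems insert.hyps by simp
    from insert.IH[OF insert.prems(1) this] True show ?thesis by fastforce
  next
    case False
    then obtain t0 where t0: "t0 \<in> T" "a r t0 \<noteq> 0" by blast
    let ?T = "T - {t0}"
    have "finite ?T" "card Q < card ?T" using insert.prems insert.hyps t0 by auto
    from insert.IH[OF this, of "\<lambda>s t. a s t - a s t0 * a r t / a r t0"]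
    obtain w where w: "\<exists>t\<in>?T. w t \<noteq> 0"
      and 0: "\<And>s. s \<in> Q \<Longrightarrow> (\<Sum>t\<in>?T. w t * (a s t - a s t0 * a r t / a r t0)) = 0" by blast
    define R where "R = (\<Sum>t\<in>?T. w t * a r t)"
    \<comment> \<open>The eliminated unknown takes the value that satisfies equation
      \<open>r\<close>; the reduced coefficients were chosen so that the other equations then hold
      as well.\<close>
    define w' where "w' = w(t0 := - R / a r t0)"
    have split: "(\<Sum>t\<in>T. w' t * a s t) = - R / a r t0 * a s t0 + (\<Sum>t\<in>?T. w t * a s t)" for s
      unfolding sum.remove[OF insert.prems(1) t0(1)] by (simp add: w'_def)
    have "(\<Sum>t\<in>T. w' t * a s t) = 0" if "s \<in> insert r Q" for s
    proof (cases "s = r")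
      case True then show ?thesis unfolding split using t0 by (simp add: R_def)
    next
      case False
      have "(\<Sum>t\<in>?T. w t * (a s t - a s t0 * a r t / a r t0)) = (\<Sum>t\<in>?T. w t * a s t) - a s t0 / a r t0 * R"
        unfolding R_def sum_distrib_left sum_subtractf[symmetric]
        by (intro sum.cong refl) (simp add: algebra_simps)
      with 0[of s] False that show ?thesis unfolding split by simp
    qed
    moreover have "\<exists>t\<in>T. w' t \<noteq> 0" using w by (auto simp: w'_def)
    ultimately show ?thesis by blast
  qed
qed

text \<open>A symmetric bilinear form is recovered from its quadratic form: if the latter vanished
  at \<open>\<delta> i\<close>, \<open>\<delta> j\<close> and their sum, then
  \<open>2 * \<Omega> i j\<close> would be zero.\<close>

lemma symmetric_form_nonzero:
  fixes \<Omega> :: "'a \<Rightarrow> 'a \<Rightarrow> real"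
  assumes W: "finite W" and ij: "i \<in> W" "j \<in> W" "\<Omega> i j \<noteq> 0" and sym: "\<And>i j. \<Omega> i j = \<Omega> j i"
  obtains \<sigma> where "(\<Sum>i\<in>W. \<Sum>j\<in>W. \<Omega> i j * \<sigma> i * \<sigma> j) \<noteq> 0"
proof -
  define B where "B = (\<lambda>\<sigma> \<tau>. \<Sum>i\<in>W. \<Sum>j\<in>W. \<Omega> i j * \<sigma> i * \<tau> j)"
  define \<delta> :: "'a \<Rightarrow> 'a \<Rightarrow> real" where "\<delta> = (\<lambda>a i. if i = a then 1 else 0)"
  have B: "B (\<delta> a) (\<delta> b) = \<Omega> a b" if "a \<in> W" "b \<in> W" for a b
  proof -
    have "B (\<delta> a) (\<delta> b) = (\<Sum>i\<in>W. if i = a then \<Sum>j\<in>W. if j = b then \<Omega> a b else 0 else 0)"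
      unfolding B_def by (intro sum.cong refl) (auto simp: \<delta>_def intro!: sum.cong)
    also have "\<dots> = \<Omega> a b" using that W by simp
    finally show ?thesis .
  qed
  have "B (\<lambda>l. \<delta> i l + \<delta> j l) (\<lambda>l. \<delta> i l + \<delta> j l) =
      B (\<delta> i) (\<delta> i) + B (\<delta> i) (\<delta> j) + B (\<delta> j) (\<delta> i) + B (\<delta> j) (\<delta> j)"
    unfolding B_def sum.distrib[symmetric] by (intro sum.cong refl) (simp add: algebra_simps)
  also have "\<dots> = \<Omega> i i + 2 * \<Omega> i j + \<Omega> j j" using ij sym[of j i] by (simp add: B)
  finally have "B (\<lambda>l. \<delta> i l + \<delta> j l) (\<lambda>l. \<delta> i l + \<delta> j l) \<noteq> 0 \<or> B (\<delta> i) (\<delta> i) \<noteq> 0 \<or> B (\<delta> j) (\<delta> j) \<noteq> 0"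
    using ij by (auto simp: B)
  then show thesis
    using that[of "\<lambda>l. \<delta> i l + \<delta> j l"] that[of "\<delta> i"] that[of "\<delta> j"] unfolding B_def by blast
qed

text \<open>Everything is relative to the apex \<open>x\<close>: \<open>w\<close> gives the
  velocities of \<open>W\<close>, \<open>r\<close> and \<open>p\<close> its positions before and
  after sliding, \<open>b\<close> and \<open>c\<close> the position and velocity of
  \<open>y\<close>. The sum \<open>Z\<close> of \<open>\<Omega> i j\<close> times the inner product
  of \<open>p i\<close> and \<open>w j\<close> is evaluated twice: it vanishes by
  \<open>edge\<close> and symmetry, while expanding \<open>p i\<close> and using
  \<open>stress\<close> and \<open>apex\<close> leaves a polynomial in \<open>s\<close>.\<close>

lemma stress_quadratic_identity:
  fixes \<Omega> :: "'a \<Rightarrow> 'a \<Rightarrow> real" and r w :: "'a \<Rightarrow> nat \<Rightarrow> real" and b c :: "nat \<Rightarrow> real"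
    and \<sigma> :: "'a \<Rightarrow> real" and s :: real
  defines "p \<equiv> \<lambda>i k. r i k + s * \<sigma> i * b k"
  assumes sym: "\<And>i j. \<Omega> i j = \<Omega> j i"
    and stress: "\<And>i k. i \<in> W \<Longrightarrow> k < d \<Longrightarrow> (\<Sum>j\<in>W. \<Omega> i j * r j k) = 0"
    and bc: "(\<Sum>k<d. b k * c k) = 1"
    and apex: "\<And>i. i \<in> W \<Longrightarrow> (\<Sum>k<d. p i k * c k) + (\<Sum>k<d. b k * w i k) = 1"
    and edge: "\<And>i j. i \<in> W \<Longrightarrow> j \<in> W \<Longrightarrow> \<Omega> i j \<noteq> 0 \<Longrightarrow>
      (\<Sum>k<d. p i k * w j k) + (\<Sum>k<d. p j k * w i k) = 0"
  shows "s * (\<Sum>i\<in>W. \<Sum>j\<in>W. \<Omega> i j * \<sigma> i) - s\<^sup>2 * (\<Sum>i\<in>W. \<Sum>j\<in>W. \<Omega> i j * \<sigma> i * \<sigma> j) = 0"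
proof -
  define D where "D = (\<lambda>f g :: nat \<Rightarrow> real. \<Sum>k<d. f k * g k)"
  have Dp: "D (p i) g = D (r i) g + s * \<sigma> i * D b g" for i g
    by (simp add: D_def p_def algebra_simps sum.distrib sum_distrib_left)
  have stressD: "(\<Sum>j\<in>W. \<Omega> i j * D (r j) g) = 0" if "i \<in> W" for i g
  proof -
    have "(\<Sum>j\<in>W. \<Omega> i j * D (r j) g) = (\<Sum>j\<in>W. \<Sum>k<d. \<Omega> i j * r j k * g k)"
      by (simp add: D_def sum_distrib_left mult.assoc)
    also have "\<dots> = (\<Sum>k<d. \<Sum>j\<in>W. \<Omega> i j * r j k * g k)" by (rule sum.swap)
    also have "\<dots> = (\<Sum>k<d. (\<Sum>j\<in>W. \<Omega> i j * r j k) * g k)" by (simp add: sum_distrib_right)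
    also have "\<dots> = 0" using stress[OF that] by simp
    finally show ?thesis .
  qed
  define Z where "Z = (\<Sum>i\<in>W. \<Sum>j\<in>W. \<Omega> i j * D (p i) (w j))"
  have "Z = (\<Sum>i\<in>W. \<Sum>j\<in>W. \<Omega> i j * D (p j) (w i))"
    unfolding Z_def by (subst sum.swap) (simp add: sym)
  then have "Z + Z = (\<Sum>i\<in>W. \<Sum>j\<in>W. \<Omega> i j * (D (p i) (w j) + D (p j) (w i)))"
    by (simp add: Z_def distrib_left sum.distrib)
  also have "\<dots> = 0"
    by (intro sum.neutral ballI) (use edge in \<open>auto simp: D_def\<close>)
  finally have Z0: "Z = 0" by simp
  \<comment> \<open>Here \<open>apex\<close> eliminates the velocity \<open>w j\<close>; the term
    with \<open>c\<close> is later annihilated by \<open>stress\<close>.\<close>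
  have bw: "D b (w j) = 1 - D (r j) c - s * \<sigma> j" if "j \<in> W" for j
    using apex[OF that] Dp[of j c] bc by (simp add: D_def)
  have "Z = (\<Sum>i\<in>W. \<Sum>j\<in>W. \<Omega> i j * D (r i) (w j)) + (\<Sum>i\<in>W. \<Sum>j\<in>W. s * \<sigma> i * (\<Omega> i j * D b (w j)))"
    unfolding Z_def Dp sum.distrib[symmetric] by (intro sum.cong refl) (simp add: algebra_simps)
  also have "(\<Sum>i\<in>W. \<Sum>j\<in>W. \<Omega> i j * D (r i) (w j)) = (\<Sum>j\<in>W. \<Sum>i\<in>W. \<Omega> j i * D (r i) (w j))"
    by (subst sum.swap) (simp add: sym)
  also have "\<dots> = 0" by (simp add: stressD)
  also have "(\<Sum>i\<in>W. \<Sum>j\<in>W. s * \<sigma> i * (\<Omega> i j * D b (w j))) =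
      (\<Sum>i\<in>W. \<Sum>j\<in>W. s * \<sigma> i * (\<Omega> i j - \<Omega> i j * D (r j) c - s * (\<Omega> i j * \<sigma> j)))"
    by (intro sum.cong refl) (simp add: bw algebra_simps)
  also have "\<dots> = (\<Sum>i\<in>W. s * \<sigma> i * ((\<Sum>j\<in>W. \<Omega> i j) - (\<Sum>j\<in>W. \<Omega> i j * D (r j) c) - s * (\<Sum>j\<in>W. \<Omega> i j * \<sigma> j)))"
    by (simp only: sum_distrib_left sum_subtractf[symmetric])
  also have "\<dots> = (\<Sum>i\<in>W. s * \<sigma> i * ((\<Sum>j\<in>W. \<Omega> i j) - s * (\<Sum>j\<in>W. \<Omega> i j * \<sigma> j)))"
    by (simp add: stressD)
  also have "\<dots> = s * (\<Sum>i\<in>W. \<Sum>j\<in>W. \<Omega> i j * \<sigma> i) - s\<^sup>2 * (\<Sum>i\<in>W. \<Sum>j\<in>W. \<Omega> i j * \<sigma> i * \<sigma> j)"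
    by (simp add: sum_distrib_left sum_subtractf algebra_simps power2_eq_square)
  finally show ?thesis using Z0 by simp
qed

section \<open>Bars implied by dense common neighbourhoods\<close>

definition pair :: "nat \<Rightarrow> nat \<Rightarrow> nat \<times> nat" where
  "pair u v = (min u v, max u v)"

lemma stretch_pair: "stretch d q (pair u v) h = (\<Sum>k<d. (q u k - q v k) * (h u k - h v k))"
  unfolding stretch_def pair_def by (cases "u \<le> v") (auto simp: algebra_simps intro!: sum.cong)

lemma pair_commute: "pair u v = pair v u"
  by (simp add: pair_def min.commute max.commute)

text \<open>By maximality a motion stretching no bar of \<open>es\<close> stretches no bar of
  \<open>E\<close>. The bars to \<open>x\<close> and \<open>y\<close> then give the apex conditions
  on \<open>W\<close>, and the edge count gives the stress.\<close>

lemma gram_zero_if_dense_common_neighbours: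
  assumes gen: "generic_fw n d q" and E: "E \<subseteq> all_pairs n" and es: "set es \<subseteq> E"
    and maximal: "\<And>e. e \<in> E \<Longrightarrow> gram d (es @ [e]) q = 0"
    and xy: "x < n" "y < n" and W: "W \<subseteq> {..<n}" "x \<notin> W" "y \<notin> W" "W \<noteq> {}"
    and nbrs: "\<And>i. i \<in> W \<Longrightarrow> pair x i \<in> E" "\<And>i. i \<in> W \<Longrightarrow> pair y i \<in> E"
    and dense: "d * card W \<le> card (E \<inter> W \<times> W)"
  shows "gram d (es @ [(x, y)]) q = 0"
proof (rule ccontr)
  assume nz: "gram d (es @ [(x, y)]) q \<noteq> 0"
  have En: "E \<subseteq> {..<n} \<times> {..<n}" using E by (auto simp: all_pairs_def)
  have finW: "finite W" using W(1) finite_subset by blast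
  have esxy: "set (es @ [(x, y)]) \<subseteq> {..<n} \<times> {..<n}" using es En xy by auto
  \<comment> \<open>The unknowns are the entries of a symmetric matrix: one per edge inside
    \<open>W\<close> and one per diagonal position. The diagonal ones make the count strict although
    \<open>dense\<close> is not.\<close>
  define T where "T = E \<inter> W \<times> W \<union> (\<lambda>i. (i, i)) ` W"
  have finT: "finite T" using finW by (auto simp: T_def)
  have "card T = card (E \<inter> W \<times> W) + card ((\<lambda>i. (i, i)) ` W)"
    unfolding T_def using finW E by (intro card_Un_disjoint) (auto simp: all_pairs_def)
  also have "card ((\<lambda>i. (i, i)) ` W) = card W" by (intro card_image inj_onI) auto
  finally have "card (W \<times> {..<d}) < card T"
    using dense card_gt_0_iff[of W] finW W(4) by (simp add: card_cartesian_product mult.commute)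
  moreover have "finite (W \<times> {..<d})" using finW by simp
  ultimately obtain w where w: "\<exists>t\<in>T. w t \<noteq> 0" and w0: "\<And>i k. i \<in> W \<Longrightarrow> k < d \<Longrightarrow>
      (\<Sum>t\<in>T. w t * (\<Sum>j\<in>W. if pair i j = t then q j k - q x k else 0)) = 0"
    using homogeneous_system_nontrivial[of "W \<times> {..<d}" T
        "\<lambda>(i, k) t. \<Sum>j\<in>W. if pair i j = t then q j k - q x k else 0"] finT by auto
  define \<Omega> where "\<Omega> = (\<lambda>i j. if pair i j \<in> T then w (pair i j) else 0)"
  have sym: "\<Omega> i j = \<Omega> j i" for i j by (simp add: \<Omega>_def pair_commute)
  have stress: "(\<Sum>j\<in>W. \<Omega> i j * (q j k - q x k)) = 0" if "i \<in> W" "k < d" for i k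
  proof -
    have "(\<Sum>j\<in>W. \<Omega> i j * (q j k - q x k)) =
        (\<Sum>j\<in>W. \<Sum>t\<in>T. w t * (if pair i j = t then q j k - q x k else 0))"
      using finT by (intro sum.cong refl) (simp add: \<Omega>_def if_distrib[of "\<lambda>x. _ * x"] sum.delta cong: if_cong)
    also have "\<dots> = (\<Sum>t\<in>T. \<Sum>j\<in>W. w t * (if pair i j = t then q j k - q x k else 0))" by (rule sum.swap)
    also have "\<dots> = 0" using w0[OF that] by (simp add: sum_distrib_left)
    finally show ?thesis .
  qed
  from w obtain i0 j0 where t: "(i0, j0) \<in> T" "w (i0, j0) \<noteq> 0" by auto
  then have "i0 \<in> W" "j0 \<in> W" "i0 \<le> j0" using E by (auto simp: T_def all_pairs_def)
  then have "\<Omega> i0 j0 \<noteq> 0" using t by (simp add: \<Omega>_def pair_def)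
  from symmetric_form_nonzero[of W i0 j0 \<Omega>, OF finW \<open>i0 \<in> W\<close> \<open>j0 \<in> W\<close> this sym]
  obtain \<sigma> where \<sigma>: "(\<Sum>i\<in>W. \<Sum>j\<in>W. \<Omega> i j * \<sigma> i * \<sigma> j) \<noteq> 0" by blast
  define b where "b = (\<lambda>k. q y k - q x k)"
  obtain P where P: "\<And>s. gram d (es @ [(x, y)]) (\<lambda>i k. q i k + s * (if i \<in> W then \<sigma> i * b k else 0)) = poly P s"
    using polyfun_on_line[OF polyfun_gram[OF esxy], of d q "\<lambda>i k. if i \<in> W then \<sigma> i * b k else 0"] by blast
  \<comment> \<open>The polynomial in \<open>s\<close> that \<open>stress_quadratic_identity\<close>
    forces to vanish; the choice of \<open>\<sigma>\<close> makes its quadratic coefficient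
    nonzero.\<close>
  define R where "R = [:0, \<Sum>i\<in>W. \<Sum>j\<in>W. \<Omega> i j * \<sigma> i, - (\<Sum>i\<in>W. \<Sum>j\<in>W. \<Omega> i j * \<sigma> i * \<sigma> j):]"
  have "poly P 0 \<noteq> 0" using nz P[of 0] by simp
  then have "P \<noteq> 0" by auto
  moreover have "R \<noteq> 0" using \<sigma> by (simp add: R_def)
  ultimately have "P * R \<noteq> 0" by simp
  \<comment> \<open>Outside the finitely many roots of \<open>P\<close> and \<open>R\<close>, the
    extended list stays independent after sliding while the identity fails.\<close>
  then obtain s where s: "poly P s \<noteq> 0" "poly R s \<noteq> 0" using poly_all_0_iff_0[of "P * R"] by auto
  define q' where "q' = (\<lambda>i k. q i k + s * (if i \<in> W then \<sigma> i * b k else 0))"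
  have nz': "gram d (es @ [(x, y)]) q' \<noteq> 0" using s(1) P[of s] by (simp add: q'_def)
  obtain h where h: "\<And>f. f \<in> set es \<Longrightarrow> stretch d q' f h = 0" "stretch d q' (x, y) h = 1"
    using separating_motion[OF esxy nz'] by blast
  \<comment> \<open>The slid framework need not be generic, but dependence of \<open>e\<close> on
    \<open>es\<close> at the generic \<open>q\<close> is a polynomial identity and so holds at
    \<open>q'\<close> too.\<close>
  have hE: "stretch d q' e h = 0" if "e \<in> E" for e
  proof (rule stretch_eq_zero_if_dependent)
    show "set es \<subseteq> {..<n} \<times> {..<n}" "e \<in> {..<n} \<times> {..<n}" using es En that by auto
    show "gram d es q' \<noteq> 0" by (rule gram_prefix_nonzero[OF esxy nz'])
    have "set (es @ [e]) \<subseteq> {..<n} \<times> {..<n}" using es En that by auto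
    from generic_fw_polyfun_zero[OF gen polyfun_gram[OF this] maximal[OF that]]
    show "gram d (es @ [e]) q' = 0" .
  qed (use h in auto)
  have q'xy: "q' x = q x" "q' y = q y" using W by (auto simp: q'_def)
  have "s * (\<Sum>i\<in>W. \<Sum>j\<in>W. \<Omega> i j * \<sigma> i) - s\<^sup>2 * (\<Sum>i\<in>W. \<Sum>j\<in>W. \<Omega> i j * \<sigma> i * \<sigma> j) = 0"
  proof (rule stress_quadratic_identity[where r = "\<lambda>i k. q i k - q x k" and b = b
        and c = "\<lambda>k. h y k - h x k" and w = "\<lambda>i k. h i k - h x k" and d = d])
    show "(\<Sum>k<d. b k * (h y k - h x k)) = 1"
      using h(2) by (simp add: stretch_def b_def q'xy algebra_simps)
    have p: "q i k - q x k + s * \<sigma> i * b k = q' i k - q x k" if "i \<in> W" for i k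
      using that by (simp add: q'_def)
    have x0: "(\<Sum>k<d. (q' i k - q x k) * (h i k - h x k)) = 0" if "i \<in> W" for i
      using hE[OF nbrs(1)[OF that]] unfolding pair_commute[of x] stretch_pair q'xy .
    have y0: "(\<Sum>k<d. (q' i k - q y k) * (h i k - h y k)) = 0" if "i \<in> W" for i
      using hE[OF nbrs(2)[OF that]] unfolding pair_commute[of y] stretch_pair q'xy .
    show "(\<Sum>k<d. (q i k - q x k + s * \<sigma> i * b k) * (h y k - h x k)) + (\<Sum>k<d. b k * (h i k - h x k)) = 1"
      if i: "i \<in> W" for i
    proof -
      \<comment> \<open>The stretches of the bars from \<open>i\<close> to \<open>x\<close> and to
        \<open>y\<close> are both zero; their difference leaves only the stretch of the bar
        \<open>xy\<close>, which is 1.\<close>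
      have "(\<Sum>k<d. (q' i k - q x k) * (h y k - h x k)) + (\<Sum>k<d. b k * (h i k - h x k)) =
        (\<Sum>k<d. (q' i k - q x k) * (h i k - h x k)) - (\<Sum>k<d. (q' i k - q y k) * (h i k - h y k))
        + (\<Sum>k<d. b k * (h y k - h x k))"
        unfolding sum.distrib[symmetric] sum_subtractf[symmetric] b_def
        by (intro sum.cong refl) (simp add: algebra_simps)
      then show ?thesis unfolding p[OF i] x0[OF i] y0[OF i] \<open>(\<Sum>k<d. b k * (h y k - h x k)) = 1\<close> by simp
    qed
    show "(\<Sum>k<d. (q i k - q x k + s * \<sigma> i * b k) * (h j k - h x k)) +
        (\<Sum>k<d. (q j k - q x k + s * \<sigma> j * b k) * (h i k - h x k)) = 0"
      if i: "i \<in> W" and j: "j \<in> W" and nz: "\<Omega> i j \<noteq> 0" for i j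
    proof -
      have "pair i j \<in> T" using nz by (auto simp: \<Omega>_def split: if_splits)
      \<comment> \<open>A diagonal entry of \<open>\<Omega>\<close> has no bar, but there the
        difference of positions is zero.\<close>
      then have "pair i j \<in> E \<or> i = j" by (auto simp: T_def pair_def)
      then have ij0: "(\<Sum>k<d. (q' i k - q' j k) * (h i k - h j k)) = 0"
        using hE[of "pair i j"] unfolding stretch_pair by auto
      have "(\<Sum>k<d. (q' i k - q x k) * (h j k - h x k)) + (\<Sum>k<d. (q' j k - q x k) * (h i k - h x k)) =
        (\<Sum>k<d. (q' i k - q x k) * (h i k - h x k)) + (\<Sum>k<d. (q' j k - q x k) * (h j k - h x k))
        - (\<Sum>k<d. (q' i k - q' j k) * (h i k - h j k))"
        unfolding sum.distrib[symmetric] sum_subtractf[symmetric]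
        by (intro sum.cong refl) (simp add: algebra_simps)
      then show ?thesis unfolding p[OF i] p[OF j] x0[OF i] x0[OF j] ij0 by simp
    qed
  qed (use sym stress in auto)
  moreover have "poly R s = s * (\<Sum>i\<in>W. \<Sum>j\<in>W. \<Omega> i j * \<sigma> i) - s\<^sup>2 * (\<Sum>i\<in>W. \<Sum>j\<in>W. \<Omega> i j * \<sigma> i * \<sigma> j)"
    by (simp add: R_def power2_eq_square algebra_simps)
  ultimately show False using s(2) by simp
qed

section \<open>A deterministic criterion for generic rigidity\<close>

text \<open>Repeated bars give equal rows of the Gram matrix, so independent lists are distinct and
  have length at most \<open>card E\<close>. The empty list is independent because a determinant of
  size zero is 1.\<close>

lemma maximal_independent_list:
  assumes "finite E"
  obtains es where "set es \<subseteq> E" "gram d es q \<noteq> 0" "\<And>e. e \<in> E \<Longrightarrow> gram d (es @ [e]) q = 0"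
proof -
  let ?I = "\<lambda>es. set es \<subseteq> E \<and> gram d es q \<noteq> 0"
  have len: "length es < Suc (card E)" if "?I es" for es
  proof -
    have "es ! a \<noteq> es ! b" if ab: "a < length es" "b < length es" "a \<noteq> b" for a b
    proof
      assume eq: "es ! a = es ! b"
      have "Matrix.row (gram_mat d es q) a = Matrix.row (gram_mat d es q) b"
        by (rule eq_vecI) (use ab eq in \<open>auto simp: gram_mat_def\<close>)
      from det_identical_rows[OF gram_mat_carrier ab(3,1,2) this] show False
        using \<open>?I es\<close> by (simp add: gram_def)
    qed
    then have "distinct es" by (auto simp: distinct_conv_nth)
    then have "length es = card (set es)" by (simp add: distinct_card)
    then show ?thesis using that assms by (simp add: card_mono less_Suc_eq_le)
  qed
  have "?I []" by (simp add: gram_def gram_mat_def det_dim_zero)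
  from ex_has_greatest_nat[of ?I, OF this, of length "Suc (card E)"] len
  obtain es where es: "?I es" and greatest: "\<And>es'. ?I es' \<Longrightarrow> length es' \<le> length es" by blast
  show thesis
  proof (rule that[of es])
    fix e assume "e \<in> E"
    then show "gram d (es @ [e]) q = 0" using greatest[of "es @ [e]"] es by auto
  qed (use es in auto)
qed

text \<open>A maximal independent list of edges spans all pairs at a generic \<open>q\<close>: loops
  have zero stretch, and other pairs are implied through \<open>W\<close>. Genericity then extends
  this to every framework, as \<open>rigid_fw_if_spanning\<close> demands.\<close>

lemma graph_rigid_if_dense_common_neighbours:
  assumes E: "E \<subseteq> all_pairs n"
    and dense: "\<And>x y. x < y \<Longrightarrow> y < n \<Longrightarrow> \<exists>W \<subseteq> {..<n} - {x, y}. W \<noteq> {} \<and>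
      (\<forall>i\<in>W. pair x i \<in> E \<and> pair y i \<in> E) \<and> d * card W \<le> card (E \<inter> W \<times> W)"
  shows "graph_rigid n d E"
proof -
  obtain q where q: "generic_fw n d q" using generic_fw_exists by blast
  have En: "E \<subseteq> {..<n} \<times> {..<n}" using E by (auto simp: all_pairs_def)
  then have "finite E" using finite_subset by blast
  from maximal_independent_list[OF this] obtain es where es: "set es \<subseteq> E"
    and ind: "gram d es q \<noteq> 0" and maximal: "\<And>e. e \<in> E \<Longrightarrow> gram d (es @ [e]) q = 0" by blast
  have dependent: "gram d (es @ [e]) q = 0" if e: "e \<in> {..<n} \<times> {..<n}" for e
  proof -
    obtain x y where xy: "e = (x, y)" "x < n" "y < n" using e by blast
    show ?thesis
    proof (cases "x = y")
      case True
      show ?thesis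
      proof (rule ccontr)
        assume nz: "gram d (es @ [e]) q \<noteq> 0"
        have "set (es @ [e]) \<subseteq> {..<n} \<times> {..<n}" using es En e by auto
        from separating_motion[OF this nz] obtain h where "stretch d q e h = 1" by blast
        then show False by (simp add: stretch_def xy True)
      qed
    next
      case False
      then consider "x < y" | "y < x" by linarith
      then obtain W where W: "W \<subseteq> {..<n} - {x, y}" "W \<noteq> {}"
        "\<forall>i\<in>W. pair x i \<in> E \<and> pair y i \<in> E" "d * card W \<le> card (E \<inter> W \<times> W)"
      proof cases
        case 1 from dense[OF this xy(3)] that show thesis by (elim exE conjE)
      next
        case 2
        from dense[OF this xy(2)] obtain W where "W \<subseteq> {..<n} - {y, x}" "W \<noteq> {}"
          "\<forall>i\<in>W. pair y i \<in> E \<and> pair x i \<in> E" "d * card W \<le> card (E \<inter> W \<times> W)"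
          by (elim exE conjE)
        then show thesis by (intro that[of W]) auto
      qed
      from W have "W \<subseteq> {..<n}" "x \<notin> W" "y \<notin> W"
        "\<And>i. i \<in> W \<Longrightarrow> pair x i \<in> E" "\<And>i. i \<in> W \<Longrightarrow> pair y i \<in> E" by auto
      note gram_zero_if_dense_common_neighbours[OF q E es maximal xy(2,3) this(1-3) W(2) this(4,5) W(4)]
      then show ?thesis unfolding xy(1) .
    qed
  qed
  have "gram d (es @ [e]) q' = 0" if e: "e \<in> {..<n} \<times> {..<n}" for e q'
  proof -
    have "set (es @ [e]) \<subseteq> {..<n} \<times> {..<n}" using es En e by auto
    from generic_fw_polyfun_zero[OF q polyfun_gram[OF this] dependent[OF e]] show ?thesis .
  qed
  from rigid_fw_if_spanning[OF En es ind this] q show ?thesis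
    unfolding graph_rigid_def by blast
qed

section \<open>Random graphs\<close>

text \<open>Expectation over a random subset containing each element independently with probability
  \<open>p\<close>. The ground set is arbitrary so that the pairs of a graph can be revealed in
  stages.\<close>

definition expect :: "real \<Rightarrow> 'a set \<Rightarrow> ('a set \<Rightarrow> real) \<Rightarrow> real" where
  "expect p A f = (\<Sum>E\<in>Pow A. p ^ card E * (1 - p) ^ (card A - card E) * f E)"

lemma expect_mono:
  assumes "0 \<le> p" "p \<le> 1" "\<And>E. E \<subseteq> A \<Longrightarrow> f E \<le> g E"
  shows "expect p A f \<le> expect p A g"
  unfolding expect_def using assms by (intro sum_mono mult_left_mono) auto

lemma expect_cong: "(\<And>E. E \<subseteq> A \<Longrightarrow> f E = g E) \<Longrightarrow> expect p A f = expect p A g"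
  unfolding expect_def by (intro sum.cong) auto

lemma expect_add: "expect p A (\<lambda>E. f E + g E) = expect p A f + expect p A g"
  by (simp add: expect_def distrib_left sum.distrib)

lemma expect_cmult: "expect p A (\<lambda>E. c * f E) = c * expect p A f"
  by (simp add: expect_def sum_distrib_left mult_ac)

lemma expect_sum: "expect p A (\<lambda>E. \<Sum>i\<in>I. f i E) = (\<Sum>i\<in>I. expect p A (f i))"
  unfolding expect_def sum_distrib_left by (rule sum.swap)

lemma expect_prod:
  assumes "finite A"
  shows "expect p A (\<lambda>E. \<Prod>e\<in>E. a e) = (\<Prod>e\<in>A. p * a e + (1 - p))"
proof -
  have "(\<Prod>e\<in>A. p * a e + (1 - p)) = (\<Sum>E\<in>Pow A. (\<Prod>e\<in>E. p * a e) * (\<Prod>e\<in>A - E. 1 - p))"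
    by (rule prod_add[OF assms])
  also have "\<dots> = expect p A (\<lambda>E. \<Prod>e\<in>E. a e)"
    unfolding expect_def
    by (intro sum.cong refl) (use assms in \<open>auto simp: prod.distrib card_Diff_subset finite_subset\<close>)
  finally show ?thesis by simp
qed

text \<open>Elements of \<open>S\<close> independently contribute a factor \<open>r\<close> when
  chosen and 1 otherwise: the generating function of a binomial variable.\<close>

lemma expect_power_card:
  assumes "finite A" "S \<subseteq> A"
  shows "expect p A (\<lambda>E. r ^ card (E \<inter> S)) = (1 - p + p * r) ^ card S"
proof -
  have "r ^ card (E \<inter> S) = (\<Prod>e\<in>E. if e \<in> S then r else 1)" if "E \<subseteq> A" for E
  proof -
    have "finite E" using that assms(1) finite_subset by blast
    then show ?thesis by (simp add: prod.inter_restrict[symmetric])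
  qed
  then have "expect p A (\<lambda>E. r ^ card (E \<inter> S)) = expect p A (\<lambda>E. \<Prod>e\<in>E. if e \<in> S then r else 1)"
    by (rule expect_cong)
  also have "\<dots> = (\<Prod>e\<in>A. p * (if e \<in> S then r else 1) + (1 - p))" by (rule expect_prod[OF assms(1)])
  also have "\<dots> = (\<Prod>e\<in>A. if e \<in> S then 1 - p + p * r else 1)" by (intro prod.cong) auto
  also have "\<dots> = (1 - p + p * r) ^ card S"
    using assms by (simp add: prod.inter_restrict[symmetric] Int_absorb1)
  finally show ?thesis .
qed

lemma expect_one: "finite A \<Longrightarrow> expect p A (\<lambda>E. 1) = 1"
  using expect_power_card[of A "{}" p 1] by simp

text \<open>Weights multiply over disjoint sets: independence, in the form of averaging over one
  part with the other fixed.\<close>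

lemma expect_Un:
  assumes "finite A" "finite B" "A \<inter> B = {}"
  shows "expect p (A \<union> B) f = expect p A (\<lambda>E1. expect p B (\<lambda>E2. f (E1 \<union> E2)))"
proof -
  let ?w = "\<lambda>A E. p ^ card E * (1 - p) ^ (card A - card E)"
  have "expect p A (\<lambda>E1. expect p B (\<lambda>E2. f (E1 \<union> E2))) =
      (\<Sum>(E1, E2)\<in>Pow A \<times> Pow B. ?w A E1 * ?w B E2 * f (E1 \<union> E2))"
    unfolding expect_def sum_distrib_left sum.cartesian_product[symmetric] by (simp add: mult_ac)
  also have "\<dots> = (\<Sum>E\<in>Pow (A \<union> B). ?w (A \<union> B) E * f E)"
  proof (rule sum.reindex_bij_witness[of _ "\<lambda>E. (E \<inter> A, E \<inter> B)" "\<lambda>(E1, E2). E1 \<union> E2"])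
    fix a assume "a \<in> Pow A \<times> Pow B"
    then obtain E1 E2 where a: "a = (E1, E2)" and E: "E1 \<subseteq> A" "E2 \<subseteq> B" by auto
    have fin: "finite E1" "finite E2" using E assms by (auto intro: finite_subset)
    have c: "card (E1 \<union> E2) = card E1 + card E2" "card (A \<union> B) = card A + card B"
      using E fin assms by (auto intro!: card_Un_disjoint)
    have le: "card E1 \<le> card A" "card E2 \<le> card B" using E assms by (auto intro: card_mono)
    have "card (A \<union> B) - card (E1 \<union> E2) = (card A - card E1) + (card B - card E2)"
      using c le by simp
    then show "?w (A \<union> B) (case a of (E1, E2) \<Rightarrow> E1 \<union> E2) * f (case a of (E1, E2) \<Rightarrow> E1 \<union> E2) =
        (case a of (E1, E2) \<Rightarrow> ?w A E1 * ?w B E2 * f (E1 \<union> E2))"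
      by (simp add: a c(1) power_add mult_ac)
  qed (use assms in auto)
  finally show ?thesis by (simp add: expect_def)
qed

section \<open>Common neighbours and pairs inside a vertex set\<close>

definition common_nbrs :: "nat \<Rightarrow> nat \<Rightarrow> nat \<Rightarrow> (nat \<times> nat) set \<Rightarrow> nat set" where
  "common_nbrs n x y E = {i \<in> {..<n} - {x, y}. pair x i \<in> E \<and> pair y i \<in> E}"

lemma finite_all_pairs: "finite (all_pairs n)"
  by (rule finite_subset[of _ "{..<n} \<times> {..<n}"]) (auto simp: all_pairs_def)

lemma pair_in_all_pairs: "u \<noteq> v \<Longrightarrow> u < n \<Longrightarrow> v < n \<Longrightarrow> pair u v \<in> all_pairs n"
  by (auto simp: pair_def all_pairs_def)

lemma pair_eq_iff: "pair u v = pair u' v' \<longleftrightarrow> u = u' \<and> v = v' \<or> u = v' \<and> v = u'"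
  by (auto simp: pair_def min_def max_def split: if_splits)

text \<open>The pairs from \<open>x\<close> to vertices other than \<open>y\<close> are revealed
  first. Given them, each neighbour of \<open>x\<close> found is also adjacent to \<open>y\<close>
  independently with probability \<open>p\<close>, contributing \<open>1 - p / 2\<close>; averaging
  over the first stage applies the same generating function again.\<close>

lemma expect_common_nbrs:
  assumes "x \<noteq> y" "x < n" "y < n"
  shows "expect p (all_pairs n) (\<lambda>E. (1/2) ^ card (common_nbrs n x y E)) = (1 - p\<^sup>2 / 2) ^ (n - 2)"
proof -
  define I where "I = {..<n} - {x, y}"
  define S where "S = pair x ` I"
  define B where "B = all_pairs n - S"
  have inj: "inj_on (pair u) J" for u J by (auto simp: inj_on_def pair_eq_iff)
  have SB: "all_pairs n = S \<union> B" "S \<inter> B = {}" "finite S" "finite B"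
    using assms finite_all_pairs[of n] by (auto simp: S_def B_def I_def pair_in_all_pairs)
  have inner: "expect p B (\<lambda>E2. (1/2) ^ card (common_nbrs n x y (E1 \<union> E2))) = (1 - p / 2) ^ card (E1 \<inter> S)"
    if E1: "E1 \<subseteq> S" for E1
  proof -
    define J where "J = {i \<in> I. pair x i \<in> E1}"
    have "pair x ` J = E1 \<inter> S" using E1 by (auto simp: J_def S_def)
    then have cJ: "card J = card (E1 \<inter> S)" using card_image[OF inj[of x J]] by simp
    \<comment> \<open>The pairs from \<open>y\<close> to these vertices are still unrevealed, as
      neither \<open>x\<close> nor \<open>y\<close> lies in \<open>I\<close>.\<close>
    have JB: "pair y ` J \<subseteq> B"
      using assms by (auto simp: J_def B_def S_def I_def pair_eq_iff intro!: pair_in_all_pairs)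
    have "card (common_nbrs n x y (E1 \<union> E2)) = card (E2 \<inter> pair y ` J)" if E2: "E2 \<subseteq> B" for E2
    proof -
      have "pair y ` common_nbrs n x y (E1 \<union> E2) = E2 \<inter> pair y ` J"
      proof -
        have "common_nbrs n x y (E1 \<union> E2) = {i \<in> J. pair y i \<in> E2}"
        proof -
          have "pair x i \<notin> E2" if "i \<in> I" for i using that E2 by (auto simp: B_def S_def)
          moreover have "pair y i \<notin> E1" if "i \<in> I" for i
            using that E1 assms by (auto simp: S_def I_def pair_eq_iff)
          ultimately show ?thesis by (auto simp: common_nbrs_def J_def I_def)
        qed
        then show ?thesis by auto
      qed
      then show ?thesis using card_image[OF inj[of y "common_nbrs n x y (E1 \<union> E2)"]] by simp
    qed
    then have "expect p B (\<lambda>E2. (1/2) ^ card (common_nbrs n x y (E1 \<union> E2))) =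
        expect p B (\<lambda>E2. (1/2) ^ card (E2 \<inter> pair y ` J))" by (intro expect_cong) simp
    also have "\<dots> = (1 - p + p * (1/2)) ^ card (pair y ` J)"
      by (rule expect_power_card[OF SB(4) JB])
    also have "card (pair y ` J) = card (E1 \<inter> S)" using card_image[OF inj[of y J]] cJ by simp
    finally show ?thesis by simp
  qed
  have "expect p (all_pairs n) (\<lambda>E. (1/2) ^ card (common_nbrs n x y E)) =
      expect p S (\<lambda>E1. (1 - p / 2) ^ card (E1 \<inter> S))"
    unfolding SB(1) expect_Un[OF SB(3,4,2)] by (intro expect_cong inner)
  also have "\<dots> = (1 - p + p * (1 - p / 2)) ^ card S" by (rule expect_power_card[OF SB(3) order_refl])
  also have "1 - p + p * (1 - p / 2) = 1 - p\<^sup>2 / 2" by (simp add: algebra_simps power2_eq_square)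
  also have "card S = n - 2"
    unfolding S_def card_image[OF inj] I_def using assms by (simp add: card_Diff_subset)
  finally show ?thesis .
qed

text \<open>Ordered pairs from \<open>A\<close> are increasing, decreasing or diagonal, and swapping
  exchanges the first two kinds.\<close>

lemma card_pairs_within:
  assumes "A \<subseteq> {..<n}"
  shows "card A * card A \<le> 2 * card (all_pairs n \<inter> A \<times> A) + card A"
proof -
  let ?T = "all_pairs n \<inter> A \<times> A"
  have fin: "finite A" "finite ?T" using assms finite_all_pairs finite_subset by auto
  have "A \<times> A \<subseteq> ?T \<union> prod.swap ` ?T \<union> (\<lambda>i. (i, i)) ` A"
  proof
    fix e assume "e \<in> A \<times> A"
    then obtain i j where e: "e = (i, j)" "i \<in> A" "j \<in> A" by auto
    consider "i < j" | "j < i" | "i = j" by linarith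
    then show "e \<in> ?T \<union> prod.swap ` ?T \<union> (\<lambda>i. (i, i)) ` A"
    proof cases
      case 2
      then have "(j, i) \<in> ?T" using e assms by (auto simp: all_pairs_def)
      then have "prod.swap (j, i) \<in> prod.swap ` ?T" by (rule imageI)
      then show ?thesis using e by simp
    qed (use e assms in \<open>auto simp: all_pairs_def\<close>)
  qed
  then have "card (A \<times> A) \<le> card (?T \<union> prod.swap ` ?T \<union> (\<lambda>i. (i, i)) ` A)"
    using fin by (intro card_mono) auto
  also have "\<dots> \<le> card ?T + card (prod.swap ` ?T) + card ((\<lambda>i. (i, i)) ` A)"
    by (meson card_Un_le add_le_mono le_refl order_trans)
  also have "\<dots> \<le> card ?T + card ?T + card A"
    using fin by (intro add_mono card_image_le) auto
  finally show ?thesis using fin by (simp add: card_cartesian_product)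
qed

section \<open>Union bound for non-rigidity\<close>

text \<open>In a non-rigid graph some two vertices either have fewer than \<open>k\<close> common
  neighbours, or have at least \<open>k\<close> which span at most \<open>d * n\<close> edges. Each
  failure is bounded by an expectation of a power of 1/2 and summed over all choices.\<close>

lemma Gnp_prob_rigid_ge:
  assumes p: "0 < p" "p < 1" and k: "0 < k"
  shows "1 - (2 ^ n * 2 ^ (d * n) * (1 - p / 2) ^ ((k * k - k) div 2)
      + real n ^ 2 * 2 ^ k * (1 - p\<^sup>2 / 2) ^ (n - 2)) \<le> Gnp_prob n p (graph_rigid n d)"
proof -
  let ?A = "all_pairs n"
  \<comment> \<open>All large vertex sets are included, since the common neighbourhood depends on
    the random graph itself.\<close>
  define \<A> where "\<A> = {A. A \<subseteq> {..<n} \<and> k \<le> card A}"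
  define X where "X = {(x, y). x \<noteq> y \<and> x < n \<and> y < n}"
  \<comment> \<open>Exponential Markov weights: a summand is at least 1 when at most
    \<open>d * n\<close> edges lie inside \<open>A\<close>, and never negative; \<open>g\<close>
    treats common neighbours likewise with threshold \<open>k\<close>.\<close>
  define f where "f = (\<lambda>E. \<Sum>A\<in>\<A>. 2 ^ (d * n) * (1/2::real) ^ card (E \<inter> (?A \<inter> A \<times> A)))"
  define g where "g = (\<lambda>E. \<Sum>(x, y)\<in>X. 2 ^ k * (1/2::real) ^ card (common_nbrs n x y E))"
  have fin\<A>: "finite \<A>" by (simp add: \<A>_def)
  have X_sub: "X \<subseteq> {..<n} \<times> {..<n}" by (auto simp: X_def)
  then have finX: "finite X" using finite_subset by blast
  have half: "2 ^ m * (1/2::real) ^ l \<ge> 1" if "l \<le> m" for l m :: nat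
  proof -
    have "2 ^ m * (1/2::real) ^ l = 2 ^ (m - l)"
      using that by (simp add: power_diff power_divide)
    then show ?thesis by simp
  qed
  have f0: "f E \<ge> 0" and g0: "g E \<ge> 0" for E
    by (auto simp: f_def g_def intro!: sum_nonneg)
  have bad: "1 \<le> f E + g E" if E: "E \<subseteq> ?A" and nr: "\<not> graph_rigid n d E" for E
  proof -
    define ok where "ok = (\<lambda>x y W. W \<subseteq> {..<n} - {x, y} \<and> W \<noteq> {} \<and>
      (\<forall>i\<in>W. pair x i \<in> E \<and> pair y i \<in> E) \<and> d * card W \<le> card (E \<inter> W \<times> W))"
    have "\<exists>x y. x < y \<and> y < n \<and> (\<nexists>W. ok x y W)"
      using graph_rigid_if_dense_common_neighbours[OF E, of d] nr unfolding ok_def by meson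
    then obtain x y where xy: "x < y" "y < n" and no: "\<nexists>W. ok x y W" by (elim exE conjE)
    define W where "W = common_nbrs n x y E"
    have W: "W \<subseteq> {..<n} - {x, y}" "\<forall>i\<in>W. pair x i \<in> E \<and> pair y i \<in> E" "W \<subseteq> {..<n}"
      by (auto simp: W_def common_nbrs_def)
    show ?thesis
    proof (cases "k \<le> card W")
      case True
      then have "W \<noteq> {}" using k by auto
      with no W(1,2) have "card (E \<inter> W \<times> W) < d * card W" by (auto simp: ok_def not_le[symmetric])
      also have "\<dots> \<le> d * n" using card_mono[OF _ W(3)] by simp
      finally have "card (E \<inter> (?A \<inter> W \<times> W)) \<le> d * n" using E by (simp add: Int_assoc[symmetric] Int_absorb2)
      then have "1 \<le> 2 ^ (d * n) * (1/2::real) ^ card (E \<inter> (?A \<inter> W \<times> W))" by (rule half)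
      also have "\<dots> \<le> f E"
        unfolding f_def using fin\<A> W(3) True by (intro member_le_sum) (auto simp: \<A>_def)
      finally show ?thesis using g0[of E] by simp
    next
      case False
      then have "1 \<le> 2 ^ k * (1/2::real) ^ card (common_nbrs n x y E)"
        unfolding W_def by (intro half) simp
      also have "\<dots> = (case (x, y) of (x, y) \<Rightarrow> 2 ^ k * (1/2::real) ^ card (common_nbrs n x y E))" by simp
      also have "\<dots> \<le> g E"
        unfolding g_def using finX xy by (intro member_le_sum) (auto simp: X_def)
      finally show ?thesis using f0[of E] by simp
    qed
  qed
  have "1 = expect p ?A (\<lambda>E. 1)" using expect_one[OF finite_all_pairs] by simp
  also have "\<dots> \<le> expect p ?A (\<lambda>E. of_bool (graph_rigid n d E) + (f E + g E))"
    using p bad f0 g0 by (intro expect_mono) (auto simp: of_bool_def add_nonneg_nonneg)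
  also have "\<dots> = Gnp_prob n p (graph_rigid n d) + expect p ?A f + expect p ?A g"
    by (simp add: expect_add, simp add: expect_def Gnp_prob_def of_bool_def if_distrib[of "\<lambda>x. _ * x"] cong: if_cong)
  finally have main: "1 \<le> Gnp_prob n p (graph_rigid n d) + expect p ?A f + expect p ?A g" .
  have "expect p ?A f = (\<Sum>A\<in>\<A>. 2 ^ (d * n) * (1 - p + p * (1/2)) ^ card (?A \<inter> A \<times> A))"
    unfolding f_def expect_sum expect_cmult
    by (intro sum.cong refl arg_cong2[of _ _ _ _ "(*)"] expect_power_card finite_all_pairs) auto
  also have "\<dots> \<le> (\<Sum>A\<in>\<A>. 2 ^ (d * n) * (1 - p / 2) ^ ((k * k - k) div 2))"
  proof (intro sum_mono mult_left_mono)
    fix A assume A: "A \<in> \<A>"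
    then have m: "k \<le> card A" "A \<subseteq> {..<n}" by (auto simp: \<A>_def)
    have "k * (k - 1) \<le> card A * (card A - 1)" using m(1) by (intro mult_le_mono) auto
    also have "\<dots> \<le> 2 * card (?A \<inter> A \<times> A)"
      using card_pairs_within[OF m(2)] by (simp add: diff_mult_distrib2)
    finally have "(k * k - k) div 2 \<le> card (?A \<inter> A \<times> A)" by (simp add: diff_mult_distrib2)
    then have "(1 - p / 2) ^ card (?A \<inter> A \<times> A) \<le> (1 - p / 2) ^ ((k * k - k) div 2)"
      using p by (intro power_decreasing) auto
    then show "(1 - p + p * (1/2)) ^ card (?A \<inter> A \<times> A) \<le> (1 - p / 2) ^ ((k * k - k) div 2)"
      by (simp add: algebra_simps)
  qed auto
  also have "\<dots> = real (card \<A>) * (2 ^ (d * n) * (1 - p / 2) ^ ((k * k - k) div 2))" by simp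
  also have "\<dots> \<le> 2 ^ n * (2 ^ (d * n) * (1 - p / 2) ^ ((k * k - k) div 2))"
  proof (rule mult_right_mono)
    have "card \<A> \<le> card (Pow {..<n})" by (intro card_mono) (auto simp: \<A>_def)
    then have "card \<A> \<le> 2 ^ n" by (simp add: card_Pow)
    then show "real (card \<A>) \<le> 2 ^ n" by (metis of_nat_le_iff of_nat_numeral of_nat_power)
  qed (use p in auto)
  finally have F: "expect p ?A f \<le> 2 ^ n * 2 ^ (d * n) * (1 - p / 2) ^ ((k * k - k) div 2)"
    by (simp add: mult_ac)
  have "expect p ?A g = (\<Sum>(x, y)\<in>X. 2 ^ k * (1 - p\<^sup>2 / 2) ^ (n - 2))"
    unfolding g_def case_prod_unfold expect_sum expect_cmult
    by (intro sum.cong refl arg_cong2[of _ _ _ _ "(*)"] expect_common_nbrs) (auto simp: X_def)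
  also have "\<dots> = real (card X) * (2 ^ k * (1 - p\<^sup>2 / 2) ^ (n - 2))" by simp
  also have "\<dots> \<le> real n ^ 2 * (2 ^ k * (1 - p\<^sup>2 / 2) ^ (n - 2))"
  proof (rule mult_right_mono)
    have "card X \<le> n * n" using card_mono[OF _ X_sub] by simp
    then show "real (card X) \<le> real n ^ 2" by (metis of_nat_le_iff of_nat_power power2_eq_square)
    have "p\<^sup>2 \<le> 1" using p by (simp add: power_le_one)
    then show "0 \<le> 2 ^ k * (1 - p\<^sup>2 / 2) ^ (n - 2)" by simp
  qed
  finally have G: "expect p ?A g \<le> real n ^ 2 * 2 ^ k * (1 - p\<^sup>2 / 2) ^ (n - 2)" by (simp add: mult_ac)
  show ?thesis using main F G by linarith
qed

lemma Gnp_prob_le_1: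
  assumes "0 < p" "p < 1" shows "Gnp_prob n p P \<le> 1"
proof -
  have "Gnp_prob n p P = expect p (all_pairs n) (\<lambda>E. of_bool (P E))"
    by (simp add: expect_def Gnp_prob_def of_bool_def if_distrib[of "\<lambda>x. _ * x"] cong: if_cong)
  also have "\<dots> \<le> expect p (all_pairs n) (\<lambda>E. 1)" using assms by (intro expect_mono) auto
  finally show ?thesis using expect_one[OF finite_all_pairs] by simp
qed

section \<open>Choice of constants and the limit\<close>

text \<open>Rounding down loses at most 1, which is at most half of \<open>n / L\<close> since that
  quotient is at least 2.\<close>

lemma div_ge_half_quotient:
  fixes n L :: nat
  assumes "0 < L" "2 * L \<le> n"
  shows "real n / (2 * L) \<le> real (n div L)"
proof -
  have "n = L * (n div L) + n mod L" by simp
  also have "\<dots> \<le> L * (n div L) + L" using assms(1) by (intro add_left_mono) (simp add: less_imp_le)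
  finally have "real n \<le> L * real (n div L) + L" by (metis of_nat_add of_nat_le_iff of_nat_mult)
  moreover have "2 * real L \<le> real n" using assms(2) by (metis of_nat_le_iff of_nat_mult of_nat_numeral)
  ultimately have "real n \<le> 2 * L * real (n div L)" by (simp add: algebra_simps)
  then show ?thesis using assms(1) by (simp add: field_simps)
qed

theorem theorem6p1:
  fixes p :: real
  assumes "0 < p" and "p < 1"
  shows "\<exists>\<epsilon>>0. (\<lambda>n. Gnp_prob n p (\<lambda>E. graph_rigid n (nat \<lfloor>\<epsilon> * real n\<rfloor>) E))
                 \<longlonglongrightarrow> 1"
proof -
  define \<rho> where "\<rho> = 1 - p / 2"
  define \<tau> where "\<tau> = 1 - p\<^sup>2 / 2"
  have \<rho>: "0 < \<rho>" "\<rho> < 1" using assms by (auto simp: \<rho>_def)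
  have "p\<^sup>2 < 1" using assms by (simp add: power_less_one_iff)
  then have \<tau>: "0 < \<tau>" "\<tau> < 1" using assms by (auto simp: \<tau>_def)
  have ln_neg: "ln \<rho> < 0" "ln \<tau> < 0" using \<rho> \<tau> by auto
  \<comment> \<open>With \<open>k = n div L\<close> the factor \<open>2 ^ k\<close> must not
    outweigh \<open>\<tau> ^ n\<close>, which needs \<open>ln 2 / L < - ln \<tau>\<close>.\<close>
  obtain L :: nat where L: "ln 2 / (- ln \<tau>) < real L" using reals_Archimedean2 by blast
  moreover have "0 < ln 2 / (- ln \<tau>)" using ln_neg by (intro divide_pos_pos) auto
  ultimately have L0: "0 < L" by (metis less_trans of_nat_0_less_iff)
  \<comment> \<open>The exponent of \<open>\<rho>\<close> will be at least
    \<open>n^2 / (16 * L^2)\<close>, so that power is at most \<open>exp (- 2 * c1 * n^2)\<close>.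
    With \<open>\<epsilon> = c1 / ln 2\<close> the factor \<open>2 ^ (D n * n)\<close> uses up at
    most half of this exponent.\<close>
  define c1 where "c1 = - ln \<rho> / (32 * real L ^ 2)"
  \<comment> \<open>The decay rate of \<open>\<tau> ^ n\<close> left after paying for
    \<open>2 ^ k\<close>; positive by the choice of \<open>L\<close>.\<close>
  define c2 where "c2 = - ln \<tau> - ln 2 / real L"
  define \<epsilon> where "\<epsilon> = c1 / ln 2"
  have c1: "0 < c1" unfolding c1_def using ln_neg L0 by (intro divide_pos_pos) auto
  have c2: "0 < c2" using L ln_neg L0 by (simp add: c2_def field_simps)
  have \<epsilon>: "0 < \<epsilon>" using c1 by (simp add: \<epsilon>_def)
  define D where "D = (\<lambda>n. nat \<lfloor>\<epsilon> * real n\<rfloor>)"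
  have D: "real (D n) \<le> \<epsilon> * real n" for n using \<epsilon> by (simp add: D_def)
  let ?B = "\<lambda>n. exp (real n * ln 2 - c1 * real n ^ 2) + real n ^ 2 * exp (- c2 * real n) / \<tau>\<^sup>2"
  have lower: "1 - ?B n \<le> Gnp_prob n p (graph_rigid n (D n))" if n: "4 * L + 2 \<le> n" for n
  proof -
    define k where "k = n div L"
    define m where "m = (k * k - k) div 2"
    have "4 * L div L \<le> n div L" using n by (intro div_le_mono) simp
    then have k4: "4 \<le> k" using L0 by (simp add: k_def)
    have kn: "real k \<le> real n / L" unfolding k_def by (rule of_nat_div_le_of_nat)
    have nk: "real n / (2 * L) \<le> real k" unfolding k_def using L0 n by (intro div_ge_half_quotient) auto
    \<comment> \<open>For \<open>k >= 4\<close> what is lost to subtracting \<open>k\<close> and to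
      \<open>div\<close> is absorbed by a factor of 2.\<close>
    have "k * k \<le> 4 * m"
    proof -
      have "k * k - k \<le> 2 * m + 1" unfolding m_def by linarith
      moreover have "4 * k \<le> k * k" using k4 by simp
      ultimately show ?thesis using k4 by linarith
    qed
    then have "real k * real k \<le> 4 * real m" by (metis of_nat_le_iff of_nat_mult of_nat_numeral)
    moreover have "(real n / (2 * L))\<^sup>2 \<le> (real k)\<^sup>2" using nk by (intro power_mono) auto
    ultimately have m: "real n ^ 2 / (16 * real L ^ 2) \<le> real m"
      by (simp add: power2_eq_square field_simps)
    have "real (D n * n) * ln 2 \<le> (\<epsilon> * real n * real n) * ln 2"
      using D[of n] by (simp add: mult_right_mono)
    then have e1: "real (D n * n) * ln 2 \<le> c1 * real n ^ 2"
      by (simp add: \<epsilon>_def power2_eq_square mult_ac)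
    have "real m * ln \<rho> \<le> real n ^ 2 / (16 * real L ^ 2) * ln \<rho>"
      using m ln_neg by (intro mult_right_mono_neg) auto
    then have e2: "real m * ln \<rho> \<le> - 2 * c1 * real n ^ 2" by (simp add: c1_def field_simps)
    have "2 ^ n * 2 ^ (D n * n) * \<rho> ^ m = exp (real n * ln 2) * exp (real (D n * n) * ln 2) * exp (real m * ln \<rho>)"
      unfolding exp_of_nat_mult using \<rho> by simp
    also have "\<dots> = exp (real n * ln 2 + real (D n * n) * ln 2 + real m * ln \<rho>)" by (simp add: exp_add)
    also have "\<dots> \<le> exp (real n * ln 2 - c1 * real n ^ 2)" using e1 e2 by simp
    finally have b1: "2 ^ n * 2 ^ (D n * n) * \<rho> ^ m \<le> exp (real n * ln 2 - c1 * real n ^ 2)" .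
    \<comment> \<open>The exponent \<open>n - 2\<close> costs only the constant factor
      \<open>1 / \<tau>\<^sup>2\<close>.\<close>
    have "\<tau> ^ (n - 2) = \<tau> ^ n / \<tau>\<^sup>2" using \<tau> n by (simp add: power_diff)
    moreover have "2 ^ k * \<tau> ^ n = exp (real k * ln 2 + real n * ln \<tau>)"
      using \<tau> by (simp add: exp_add exp_of_nat_mult)
    moreover have "real k * ln 2 + real n * ln \<tau> \<le> - c2 * real n"
    proof -
      have "real k * ln 2 \<le> real n / L * ln 2" using kn by (intro mult_right_mono) auto
      then show ?thesis by (simp add: c2_def algebra_simps)
    qed
    ultimately have "2 ^ k * \<tau> ^ (n - 2) \<le> exp (- c2 * real n) / \<tau>\<^sup>2"
      using \<tau> by (simp add: divide_right_mono)
    then have "real n ^ 2 * (2 ^ k * \<tau> ^ (n - 2)) \<le> real n ^ 2 * (exp (- c2 * real n) / \<tau>\<^sup>2)"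
      by (rule mult_left_mono) simp
    then have b2: "real n ^ 2 * 2 ^ k * \<tau> ^ (n - 2) \<le> real n ^ 2 * exp (- c2 * real n) / \<tau>\<^sup>2"
      by (simp add: mult.assoc)
    have "0 < k" using k4 by simp
    from Gnp_prob_rigid_ge[OF assms this, of n "D n"] b1 b2 show ?thesis
      by (simp add: \<rho>_def \<tau>_def m_def)
  qed
  have "(\<lambda>n. exp (real n * ln 2 - c1 * real n ^ 2)) \<longlonglongrightarrow> 0" using c1 by real_asymp
  moreover have "(\<lambda>n. real n ^ 2 * exp (- c2 * real n) / \<tau>\<^sup>2) \<longlonglongrightarrow> 0" using c2 \<tau> by real_asymp
  ultimately have "(\<lambda>n. 1 - ?B n) \<longlonglongrightarrow> 1 - (0 + 0)" by (intro tendsto_intros)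
  then have lim: "(\<lambda>n. 1 - ?B n) \<longlonglongrightarrow> 1" by simp
  have "(\<lambda>n. Gnp_prob n p (graph_rigid n (D n))) \<longlonglongrightarrow> 1"
  proof (rule tendsto_sandwich[OF _ _ lim tendsto_const])
    show "\<forall>\<^sub>F n in sequentially. 1 - ?B n \<le> Gnp_prob n p (graph_rigid n (D n))"
      using lower eventually_ge_at_top[of "4 * L + 2"] by (rule eventually_mono[rotated])
    show "\<forall>\<^sub>F n in sequentially. Gnp_prob n p (graph_rigid n (D n)) \<le> 1"
      using Gnp_prob_le_1[OF assms] by simp
  qed
  then show ?thesis using \<epsilon> unfolding D_def by blast
qed

end
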